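(* Let $G$ be a finite abelian group and $(G,\vartheta)$ a completely degenerate quadratic group. Let $\Phi$ be a cyclic admissible weighted permutation action (WPA) of $(G,\vartheta)$, i.e. an admissible WPA all of whose stabilizer subgroups $G_p\le G$ ($p$ in the support of $\Phi$) are cyclic. Then there exist non-negative integers $n_\alpha$ ($\alpha\in G$) such that $\Phi$ is equivalent to the direct sum of admissible coset WPAs $$\bigoplus_{\alpha\in G} n_\alpha\,\mathcal{A}[\langle\alpha\rangle].$$
   Context: Groups are written multiplicatively; $\le$ means "subgroup of" (equality allowed); $\langle\alpha,\beta\rangle$ is the subgroup generated by $\alpha,\beta$; $\widehat G$ is the group of homomorphisms $G\to\mathbb{C}^*$; $\xi_0$ is the trivial character. Quadratic groups. A quadratic group $(G,\vartheta)$ is a finite abelian group $G$ with $\vartheta:G\to\mathbb{C}^*$ satisfying $\vartheta(\alpha\beta)\vartheta(\beta\gamma)\vartheta(\gamma\alpha)=\vartheta(\alpha)\vartheta(\beta)\vartheta(\gamma)\vartheta(\alpha\beta\gamma)$ and $\vartheta(\alpha^n)=\vartheta(\alpha)^{n^2}$ for all $\alpha,\beta,\gamma\in G$, $n\in\mathbb{Z}$. It is completely degenerate if $\vartheta(\alpha\beta)=\vartheta(\alpha)\vartheta(\beta)$ for all $\alpha,\beta\in G$; equivalently, $\vartheta$ is a $\pm1$-valued character of $G$. From now on $(G,\vartheta)$ is completely degenerate. WPAs. A weighted permutation action (WPA) of $(G,\vartheta)$ is a pair $\Phi=(X,\omega)$ where $X$ (the support) is a finite set on which $G$ acts by permutations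 and $\omega:X\to\mathbb{C}^*$ satisfies $\frac{\omega(\alpha p)\,\omega(\beta p)}{\omega(p)\,\omega(\alpha\beta p)}=\frac{\vartheta(\alpha)\vartheta(\beta)}{\vartheta(\alpha\beta)}$ for all $p\in X$, $\alpha,\beta\in G$ (the right-hand side is $1$ in the completely degenerate case). Direct sum $\oplus$ is disjoint union of supports with the obvious action and weight; $n\Phi$ is the direct sum of $n$ copies of $\Phi$. Two WPAs $(X,\omega)$, $(X',\omega')$ are equivalent if there is a $G$-equivariant bijection $f:X\to X'$ such that $\omega'(f(p))/\omega(p)$ is constant on each $G$-orbit. Coset WPAs. For $\xi\in\widehat G$ and $H\le\ker(\xi\vartheta)$, $\mathcal{W}[H,\xi]$ denotes (the equivalence class of) the WPA with support $G/H$, $G$ acting by translations, and weight $\omega(\alpha H)=\vartheta(\alpha)/\xi(\alpha)$. Every WPA is equivalent to a direct sum of coset WPAs $\bigoplus_i n_i\mathcal{W}[H_i,\xi_i]$ with uniquely determined multiplicities (over distinct pairs $(H_i,\xi_i)$). The function $\Upsilon$. For $\Phi=(X,\omega)$ and $\alpha,\beta\in G$, let $\mathrm{Fix}_\Phi(\alpha)=\{p\in X:\alpha p=p\}$ and $\Upsilon_\Phi(\alpha,\beta)=\vartheta(\beta)\sum_{p\in \mathrm{Fix}_\Phi(\alpha)}\frac{\omega(p)}{\omega(\beta p)}$. Admissibility. $\Phi$ is Galois invariant if, in its decomposition into coset WPAs, the multiplicities of $\mathcal{W}[H,\xi]$ and $\mathcal{W}[H,\xi^l]$ are equal for every $(H,\xi)$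 and every integer $l$ coprime to the exponent of $G$. $\Phi$ satisfies reciprocity if $\Upsilon_\Phi(\alpha,\beta)=\Upsilon_\Phi(\beta,\alpha)$ for all $\alpha,\beta\in G$. $\Phi$ satisfies boundedness if $|\Upsilon_\Phi(\alpha,\beta)|\le|\mathrm{Fix}_\Phi(\alpha)\cap \mathrm{Fix}_\Phi(\beta)|$ for all $\alpha,\beta\in G$. $\Phi$ is admissible if it satisfies all three. Admissible coset WPAs. For $H\le G$ put $H_0=H\cap\ker\vartheta$. If $H\ne H_0$, $$\mathcal{A}[H]=\Big(\bigoplus_{\phi\in\widehat G,\ H\le\ker(\vartheta\phi)}\mathcal{W}[H,\phi]\Big)\oplus\Big(\bigoplus_{\phi\in\widehat G,\ H\le\ker\phi}\mathcal{W}[H_0,\phi]\Big);$$ if $H=H_0$, then $\mathcal{A}[H]=\bigoplus_{\phi\in\widehat G,\ H\le\ker\phi}\mathcal{W}[H,\phi]$. *)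

theory Defs
  imports Complex_Main "HOL-Algebra.Algebra"
begin

definition complex_units :: "complex monoid" where
  "complex_units = \<lparr>carrier = UNIV - {0}, monoid.mult = (*), one = 1\<rparr>"

(* Characters are extensional on the carrier, so that they are in bijection with the
   homomorphisms from G to the units of the complex numbers and can be used as indices. *)
definition characters :: "('a, 'm) monoid_scheme \<Rightarrow> ('a \<Rightarrow> complex) set" where
  "characters G = hom G complex_units \<inter> extensional (carrier G)"

definition char_power :: "('a, 'm) monoid_scheme \<Rightarrow> ('a \<Rightarrow> complex) \<Rightarrow> int \<Rightarrow> 'a \<Rightarrow> complex" where
  "char_power G \<xi> l = (\<lambda>\<alpha>\<in>carrier G. \<xi> \<alpha> powi l)"

definition group_exponent :: "('a, 'm) monoid_scheme \<Rightarrow> nat" where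
  "group_exponent G = (LEAST n. 0 < n \<and> (\<forall>\<alpha>\<in>carrier G. \<alpha> [^]\<^bsub>G\<^esub> n = \<one>\<^bsub>G\<^esub>))"

locale quadratic_group = comm_group G for G (structure) +
  fixes \<theta> :: "'a \<Rightarrow> complex"
  assumes finite_carrier: "finite (carrier G)"
    and theta_closed: "\<theta> \<in> carrier G \<rightarrow> carrier complex_units"
    and theta_quadratic:
      "\<lbrakk>\<alpha> \<in> carrier G; \<beta> \<in> carrier G; \<gamma> \<in> carrier G\<rbrakk> \<Longrightarrow>
         \<theta> (\<alpha> \<otimes> \<beta>) * \<theta> (\<beta> \<otimes> \<gamma>) * \<theta> (\<gamma> \<otimes> \<alpha>) = \<theta> \<alpha> * \<theta> \<beta> * \<theta> \<gamma> * \<theta> (\<alpha> \<otimes> \<beta> \<otimes> \<gamma>)"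
    and theta_int_pow: "\<alpha> \<in> carrier G \<Longrightarrow> \<theta> (\<alpha> [^] (n::int)) = \<theta> \<alpha> powi (n\<^sup>2)"

locale completely_degenerate_quadratic_group = quadratic_group +
  assumes theta_mult:
    "\<lbrakk>\<alpha> \<in> carrier G; \<beta> \<in> carrier G\<rbrakk> \<Longrightarrow> \<theta> (\<alpha> \<otimes> \<beta>) = \<theta> \<alpha> * \<theta> \<beta>"

record ('a, 'x) wpa =
  support :: "'x set"
  act :: "'a \<Rightarrow> 'x \<Rightarrow> 'x"
  weight :: "'x \<Rightarrow> complex"

locale weighted_permutation_action = quadratic_group G \<theta> for G (structure) and \<theta> +
  fixes \<Phi> :: "('a, 'x) wpa"
  assumes finite_support: "finite (support \<Phi>)"
    and action: "group_action G (support \<Phi>) (act \<Phi>)"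
    and weight_closed: "weight \<Phi> \<in> support \<Phi> \<rightarrow> carrier complex_units"
    and weight_act:
      "\<lbrakk>p \<in> support \<Phi>; \<alpha> \<in> carrier G; \<beta> \<in> carrier G\<rbrakk> \<Longrightarrow>
         weight \<Phi> (act \<Phi> \<alpha> p) * weight \<Phi> (act \<Phi> \<beta> p)
           / (weight \<Phi> p * weight \<Phi> (act \<Phi> (\<alpha> \<otimes> \<beta>) p))
         = \<theta> \<alpha> * \<theta> \<beta> / \<theta> (\<alpha> \<otimes> \<beta>)"

definition wpa_equiv :: "('a, 'm) monoid_scheme \<Rightarrow> ('a, 'x) wpa \<Rightarrow> ('a, 'y) wpa \<Rightarrow> bool" where
  "wpa_equiv G \<Phi> \<Psi> \<longleftrightarrow>
     (\<exists>f. bij_betw f (support \<Phi>) (support \<Psi>) \<and>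
          (\<forall>\<alpha>\<in>carrier G. \<forall>p\<in>support \<Phi>. f (act \<Phi> \<alpha> p) = act \<Psi> \<alpha> (f p)) \<and>
          (\<forall>B\<in>orbits G (support \<Phi>) (act \<Phi>). \<exists>c. \<forall>p\<in>B. weight \<Psi> (f p) / weight \<Phi> p = c))"

definition direct_sum :: "'i set \<Rightarrow> ('i \<Rightarrow> ('a, 'x) wpa) \<Rightarrow> ('a, 'i \<times> 'x) wpa" where
  "direct_sum I \<Phi> =
     \<lparr>support = (SIGMA i:I. support (\<Phi> i)),
      act = (\<lambda>\<alpha>. \<lambda>(i, p)\<in>(SIGMA i:I. support (\<Phi> i)). (i, act (\<Phi> i) \<alpha> p)),
      weight = (\<lambda>(i, p). weight (\<Phi> i) p)\<rparr>"

definition copies :: "nat \<Rightarrow> ('a, 'x) wpa \<Rightarrow> ('a, nat \<times> 'x) wpa" where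
  "copies n \<Phi> = direct_sum {..<n} (\<lambda>_. \<Phi>)"

(* The weight is well defined when H is contained in the kernel of xi * theta (the only case
   used): alpha |-> theta alpha / xi alpha is then constant on each coset of H. *)
definition coset_wpa ::
    "('a, 'm) monoid_scheme \<Rightarrow> ('a \<Rightarrow> complex) \<Rightarrow> 'a set \<Rightarrow> ('a \<Rightarrow> complex) \<Rightarrow> ('a, 'a set) wpa" where
  "coset_wpa G \<theta> H \<xi> =
     \<lparr>support = lcosets\<^bsub>G\<^esub> H,
      act = (\<lambda>\<alpha>. \<lambda>C\<in>lcosets\<^bsub>G\<^esub> H. \<alpha> <#\<^bsub>G\<^esub> C),
      weight = (\<lambda>C. the_elem ((\<lambda>\<alpha>. \<theta> \<alpha> / \<xi> \<alpha>) ` C))\<rparr>"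

definition coset_params ::
    "('a, 'm) monoid_scheme \<Rightarrow> ('a \<Rightarrow> complex) \<Rightarrow> ('a set \<times> ('a \<Rightarrow> complex)) set" where
  "coset_params G \<theta> =
     {(H, \<xi>). subgroup H G \<and> \<xi> \<in> characters G \<and> H \<subseteq> kernel G complex_units (\<lambda>\<alpha>. \<xi> \<alpha> * \<theta> \<alpha>)}"

(* m (H, xi) is the multiplicity of W[H, xi] in Phi. *)
definition coset_decomposition ::
    "('a, 'm) monoid_scheme \<Rightarrow> ('a \<Rightarrow> complex) \<Rightarrow> ('a, 'x) wpa
      \<Rightarrow> ('a set \<times> ('a \<Rightarrow> complex) \<Rightarrow> nat) \<Rightarrow> bool" where
  "coset_decomposition G \<theta> \<Phi> m \<longleftrightarrow>
     wpa_equiv G \<Phi>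
       (direct_sum (coset_params G \<theta>) (\<lambda>(H, \<xi>). copies (m (H, \<xi>)) (coset_wpa G \<theta> H \<xi>)))"

(* Multiplicities exist and are unique on coset_params, so the existential quantifier picks out
   the decomposition of Phi. When theta is a character, coset_params is closed under
   (H, xi) |-> (H, xi^l) for l coprime to the exponent. *)
definition galois_invariant ::
    "('a, 'm) monoid_scheme \<Rightarrow> ('a \<Rightarrow> complex) \<Rightarrow> ('a, 'x) wpa \<Rightarrow> bool" where
  "galois_invariant G \<theta> \<Phi> \<longleftrightarrow>
     (\<exists>m. coset_decomposition G \<theta> \<Phi> m \<and>
          (\<forall>(H, \<xi>)\<in>coset_params G \<theta>. \<forall>l::int. coprime l (int (group_exponent G)) \<longrightarrow>
             m (H, \<xi>) = m (H, char_power G \<xi> l)))"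

definition fixed_points :: "('a, 'x) wpa \<Rightarrow> 'a \<Rightarrow> 'x set" where
  "fixed_points \<Phi> \<alpha> = invariants (support \<Phi>) (act \<Phi>) \<alpha>"

definition Upsilon :: "('a \<Rightarrow> complex) \<Rightarrow> ('a, 'x) wpa \<Rightarrow> 'a \<Rightarrow> 'a \<Rightarrow> complex" where
  "Upsilon \<theta> \<Phi> \<alpha> \<beta> = \<theta> \<beta> * (\<Sum>p\<in>fixed_points \<Phi> \<alpha>. weight \<Phi> p / weight \<Phi> (act \<Phi> \<beta> p))"

definition reciprocity ::
    "('a, 'm) monoid_scheme \<Rightarrow> ('a \<Rightarrow> complex) \<Rightarrow> ('a, 'x) wpa \<Rightarrow> bool" where
  "reciprocity G \<theta> \<Phi> \<longleftrightarrow>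
     (\<forall>\<alpha>\<in>carrier G. \<forall>\<beta>\<in>carrier G. Upsilon \<theta> \<Phi> \<alpha> \<beta> = Upsilon \<theta> \<Phi> \<beta> \<alpha>)"

definition boundedness ::
    "('a, 'm) monoid_scheme \<Rightarrow> ('a \<Rightarrow> complex) \<Rightarrow> ('a, 'x) wpa \<Rightarrow> bool" where
  "boundedness G \<theta> \<Phi> \<longleftrightarrow>
     (\<forall>\<alpha>\<in>carrier G. \<forall>\<beta>\<in>carrier G.
        cmod (Upsilon \<theta> \<Phi> \<alpha> \<beta>) \<le> real (card (fixed_points \<Phi> \<alpha> \<inter> fixed_points \<Phi> \<beta>)))"

definition admissible ::
    "('a, 'm) monoid_scheme \<Rightarrow> ('a \<Rightarrow> complex) \<Rightarrow> ('a, 'x) wpa \<Rightarrow> bool" where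
  "admissible G \<theta> \<Phi> \<longleftrightarrow>
     galois_invariant G \<theta> \<Phi> \<and> reciprocity G \<theta> \<Phi> \<and> boundedness G \<theta> \<Phi>"

definition cyclic_wpa :: "('a, 'm) monoid_scheme \<Rightarrow> ('a, 'x) wpa \<Rightarrow> bool" where
  "cyclic_wpa G \<Phi> \<longleftrightarrow>
     (\<forall>p\<in>support \<Phi>. cyclic_group (G\<lparr>carrier := stabilizer G (act \<Phi>) p\<rparr>))"

(* The pairs (K, phi) indexing the summands W[K, phi] of A[H]. In the first case the two index
   sets are disjoint because H and H0 differ, so their union indexes the direct sum of the
   two families. *)
definition admissible_coset_params ::
    "('a, 'm) monoid_scheme \<Rightarrow> ('a \<Rightarrow> complex) \<Rightarrow> 'a set \<Rightarrow> ('a set \<times> ('a \<Rightarrow> complex)) set" where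
  "admissible_coset_params G \<theta> H =
     (let H0 = H \<inter> kernel G complex_units \<theta> in
      if H \<noteq> H0
      then {(H, \<phi>) |\<phi>. \<phi> \<in> characters G \<and> H \<subseteq> kernel G complex_units (\<lambda>\<alpha>. \<theta> \<alpha> * \<phi> \<alpha>)} \<union>
           {(H0, \<phi>) |\<phi>. \<phi> \<in> characters G \<and> H \<subseteq> kernel G complex_units \<phi>}
      else {(H, \<phi>) |\<phi>. \<phi> \<in> characters G \<and> H \<subseteq> kernel G complex_units \<phi>})"

definition admissible_coset_wpa ::
    "('a, 'm) monoid_scheme \<Rightarrow> ('a \<Rightarrow> complex) \<Rightarrow> 'a set
      \<Rightarrow> ('a, ('a set \<times> ('a \<Rightarrow> complex)) \<times> 'a set) wpa" where
  "admissible_coset_wpa G \<theta> H =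
     direct_sum (admissible_coset_params G \<theta> H) (\<lambda>(K, \<phi>). coset_wpa G \<theta> K \<phi>)"

end

theory Submission
  imports Defs
begin

text \<open>Let \<open>m (H, \<xi>)\<close> be the multiplicity of \<open>\<W>[H, \<xi>]\<close> in \<open>\<Phi>\<close>. Then
  \<open>\<Upsilon>(a, b) = \<Sum> m (H, \<xi>) [a \<in> H] |G : H| \<xi>(b)\<close>, and for \<open>\<A>[K]\<close> this sum is symmetric and supported
  on \<open>a, b \<in> K\<close> by orthogonality of characters. The multiplicity of \<open>\<A>[K]\<close> can only be
  \<open>m (K, \<theta>)\<close>, since \<open>\<W>[K, \<theta>]\<close> occurs in no \<open>\<A>[L]\<close> with \<open>L \<noteq> K\<close>. Subtracting
  \<open>\<Sum> m (K, \<theta>) \<A>[K]\<close> leaves integer multiplicities \<open>d\<close> with \<open>d (K, \<theta>) = 0\<close> and a symmetric \<open>\<Upsilon>\<close>, which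
  by boundedness vanishes on pairs that generate a noncyclic group. Downward induction on \<open>H\<close> gives
  \<open>d (H, \<xi>) = 0\<close>.\<close>

section \<open>Characters of finite abelian groups\<close>

text \<open>The \<open>n\<close> of the theorem must be natural numbers, although the argument
  subtracts. Reading each one off as a multiplicity of \<open>\<Phi>\<close> itself makes
  nonnegativity automatic, and the remainder \<open>d\<close> may then have either sign: only
  symmetry and vanishing are passed on to it, and both are linear conditions. Boundedness enters as
  follows. Two elements that lie in no common cyclic subgroup have no common fixed point, because it
  would have a cyclic stabilizer containing both; so the bound is 0. For the other pairs, symmetry
  is what makes progress. In \<Upsilon>(a, b) the first argument decides which subgroups occur and
  the second is only inserted into characters. Swapping the arguments after replacing b by a
  generator of the larger cyclic group leaves only subgroups that the induction has already
  settled.\<close>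

lemma complex_units_simps [simp]:
  "carrier complex_units = UNIV - {0}" "x \<otimes>\<^bsub>complex_units\<^esub> y = x * y" "\<one>\<^bsub>complex_units\<^esub> = 1"
  by (simp_all add: complex_units_def)

lemma ex_complex_nth_root:
  assumes "n > 0"
  shows "\<exists>z::complex. z ^ n = w"
proof
  show "rcis (root n (cmod w)) (Arg w / n) ^ n = w"
    using assms by (simp add: DeMoivre2 rcis_cmod_Arg)
qed

lemma ex_nontrivial_root_of_unity:
  assumes "n > 1"
  shows "\<exists>z::complex. z ^ n = 1 \<and> z \<noteq> 1"
proof (rule ccontr)
  assume "\<not> ?thesis"
  then have "{z::complex. z ^ n = 1} \<subseteq> {1}" by blast
  then have "card {z::complex. z ^ n = 1} \<le> 1"
    using card_mono[of "{1::complex}"] by simp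
  with card_roots_unity_eq[of n] assms show False by simp
qed

text \<open>Take for \<open>k\<close> the product of the primes of \<open>n\<close> that miss
  \<open>b\<close>. A prime of \<open>n\<close> then divides exactly one of \<open>b\<close> and
  \<open>k * a\<close>: if it divides \<open>b\<close>, it divides neither \<open>a\<close>, by
  coprimality, nor \<open>k\<close>, by construction.\<close>

lemma coprime_add_mult_ex:
  fixes a b n :: nat
  assumes "coprime a b" "n > 0"
  shows "\<exists>k. coprime (b + k * a) n"
proof -
  define k where "k = \<Prod>{p. Factorial_Ring.prime p \<and> p dvd n \<and> \<not> p dvd b}"
  have fin: "finite {p. Factorial_Ring.prime p \<and> p dvd n \<and> \<not> p dvd b}"
    using assms(2) by (intro finite_subset[OF _ finite_divisors_nat[of n]]) auto
  have "coprime (b + k * a) n"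
  proof (rule ccontr)
    assume "\<not> ?thesis"
    then obtain p where p: "Factorial_Ring.prime p" "p dvd b + k * a" "p dvd n"
      using prime_factor_nat[of "gcd (b + k * a) n"] by (auto simp: coprime_iff_gcd_eq_1)
    show False
    proof (cases "p dvd b")
      case True
      then have "p dvd k * a" using p(2) by (simp add: dvd_add_right_iff)
      moreover have "\<not> p dvd a"
        using True p(1) assms(1) coprime_common_divisor not_prime_unit by blast
      ultimately have "p dvd k"
        using p(1) by (simp add: prime_dvd_mult_iff)
      then obtain q where "q \<in> {p. Factorial_Ring.prime p \<and> p dvd n \<and> \<not> p dvd b}" "p dvd q"
        unfolding k_def using prime_dvd_prod_iff[OF fin p(1)] by auto
      then show False using True p(1) primes_dvd_imp_eq by auto
    next
      case False
      then have "p dvd k" unfolding k_def using p dvd_prodI[OF fin, of p id] by simp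
      then show False using False p(2) by (simp add: dvd_add_left_iff)
    qed
  qed
  then show ?thesis ..
qed

section \<open>Extending characters from subgroups\<close>

context comm_group
begin

text \<open>The number \<open>n\<close> is the order of the coset of \<open>x\<close> in G/H,
  expressed through powers of \<open>x\<close> to avoid building the quotient.\<close>

lemma ex_order_mod_subgroup:
  assumes fin: "finite (carrier G)" and H: "subgroup H G" and x: "x \<in> carrier G"
  obtains n :: nat where "n > 0" "x [^] n \<in> H" "\<And>k::nat. x [^] k \<in> H \<Longrightarrow> n dvd k"
proof -
  interpret H: subgroup H G by fact
  define n where "n = (LEAST n::nat. n > 0 \<and> x [^] n \<in> H)"
  have "\<exists>n::nat. n > 0 \<and> x [^] n \<in> H"
    using fin x by (intro exI[of _ "ord x"]) (use ord_ge_1[OF fin x] in simp)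
  then have n: "n > 0" "x [^] n \<in> H"
    unfolding n_def by (rule LeastI2_ex; simp)+
  have pow_in: "(x [^] n) [^] m \<in> H" for m :: nat
    using n(2) by (induction m) auto
  have "n dvd k" if k: "x [^] k \<in> H" for k :: nat
  proof -
    have "x [^] k = (x [^] n) [^] (k div n) \<otimes> x [^] (k mod n)"
      using x by (simp add: nat_pow_pow nat_pow_mult)
    then have "x [^] (k mod n) = inv ((x [^] n) [^] (k div n)) \<otimes> x [^] k"
      using x by (simp add: m_assoc[symmetric])
    then have "x [^] (k mod n) \<in> H"
      using k pow_in by simp
    then have "k mod n = 0"
      using not_less_Least[of "k mod n" "\<lambda>n. n > 0 \<and> x [^] n \<in> H"] n(1)
      by (auto simp: n_def[symmetric])
    then show ?thesis by auto
  qed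
  with n that show thesis by blast
qed

text \<open>The only candidate sends \<open>h \<otimes> x [^] k\<close> to
  \<open>\<chi> h * z ^ k\<close>; it is well defined because \<open>n\<close> is the order of
  \<open>x\<close> modulo \<open>H\<close> and \<open>z ^ n\<close> has the right value. The root
  \<open>z\<close> stays a parameter: extension takes any root, separation of points takes a
  nontrivial root of unity.\<close>

lemma character_extend_step:
  assumes fin: "finite (carrier G)" and H: "subgroup H G"
    and \<chi>: "\<chi> \<in> hom (G\<lparr>carrier := H\<rparr>) complex_units"
    and x: "x \<in> carrier G" and n: "n > 0" "x [^] n \<in> H" "\<And>k::nat. x [^] k \<in> H \<Longrightarrow> n dvd k"
    and z: "z ^ n = \<chi> (x [^] n)"
  obtains H' \<chi>' where "subgroup H' G" "H \<subseteq> H'" "x \<in> H'"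
    "\<chi>' \<in> hom (G\<lparr>carrier := H'\<rparr>) complex_units" "\<And>h. h \<in> H \<Longrightarrow> \<chi>' h = \<chi> h" "\<chi>' x = z"
proof -
  interpret H: subgroup H G by fact
  have \<chi>_mult: "\<chi> (a \<otimes> b) = \<chi> a * \<chi> b" if "a \<in> H" "b \<in> H" for a b
    using \<chi> that by (auto simp: hom_def)
  have \<chi>_nz: "\<chi> a \<noteq> 0" if "a \<in> H" for a
    using \<chi> that by (auto simp: hom_def)
  have \<chi>_one: "\<chi> \<one> = 1"
    using \<chi>_mult[of \<one> \<one>] \<chi>_nz[of \<one>] by simp
  have pow_closed: "a [^] k \<in> H" if "a \<in> H" for a and k :: nat
    using that by (induction k) auto
  have \<chi>_pow: "\<chi> (a [^] k) = \<chi> a ^ k" if "a \<in> H" for a and k :: nat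
    using that by (induction k) (simp_all add: \<chi>_one \<chi>_mult pow_closed)
  have z_nz: "z \<noteq> 0"
    using z \<chi>_nz[OF n(2)] n(1) by (auto simp: zero_power)
  \<comment> \<open>Natural exponents reach all of the subgroup generated by \<open>H\<close> and
    \<open>x\<close>, since \<open>x\<close> has finite order.\<close>
  define H' where "H' = {h \<otimes> x [^] k |h k. h \<in> H \<and> k \<in> (UNIV::nat set)}"
  have "H' = H <#> generate G {x}"
    unfolding H'_def set_mult_def generate_pow_on_finite_carrier[OF fin x] by auto
  then have sub: "subgroup H' G"
    using mult_subgroups[OF H generate_is_subgroup[of "{x}"]] x by simp
  have key': "\<chi> h * z ^ k = \<chi> h' * z ^ l"
    if h: "h \<in> H" "h' \<in> H" "h \<otimes> x [^] k = h' \<otimes> x [^] l" and "l \<le> k" for h h' and k l :: nat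
  proof -
    have "h \<otimes> x [^] (k - l) \<otimes> x [^] l = h' \<otimes> x [^] l"
      using h x \<open>l \<le> k\<close> by (simp add: m_assoc nat_pow_mult)
    then have e: "h \<otimes> x [^] (k - l) = h'"
      using h(1,2) x by simp
    then have "x [^] (k - l) = inv h \<otimes> h'"
      using h(1) x by (auto simp: m_assoc[symmetric])
    then have in_H: "x [^] (k - l) \<in> H" using h by simp
    \<comment> \<open>The two representations differ by a power of \<open>x\<close> lying in
      \<open>H\<close>, so its exponent is a multiple of \<open>n\<close>, where the hypothesis on
      \<open>z\<close> fixes the value.\<close>
    from n(3)[OF this] obtain q where q: "k - l = n * q" by auto
    have \<chi>_diff: "\<chi> (x [^] (k - l)) = z ^ (k - l)"
      using x \<chi>_pow[OF n(2), of q] by (simp add: q power_mult z nat_pow_pow)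
    have "\<chi> h' = \<chi> h * z ^ (k - l)"
      using \<chi>_mult[OF h(1) in_H] unfolding e \<chi>_diff .
    then show ?thesis
      using \<open>l \<le> k\<close> by (simp flip: power_add)
  qed
  have key: "\<chi> h * z ^ k = \<chi> h' * z ^ l"
    if "h \<in> H" "h' \<in> H" "h \<otimes> x [^] k = h' \<otimes> x [^] l" for h h' and k l :: nat
  proof (cases "l \<le> k")
    case False
    then show ?thesis using key'[OF that(2,1) that(3)[symmetric]] by simp
  qed (rule key'[OF that])
  define \<chi>' where "\<chi>' y = (THE w. \<exists>h\<in>H. \<exists>k::nat. y = h \<otimes> x [^] k \<and> w = \<chi> h * z ^ k)" for y
  have \<chi>': "\<chi>' (h \<otimes> x [^] k) = \<chi> h * z ^ k" if "h \<in> H" for h and k :: nat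
    unfolding \<chi>'_def
  proof (rule the_equality)
    show "\<exists>h'\<in>H. \<exists>l. h \<otimes> x [^] k = h' \<otimes> x [^] l \<and> \<chi> h * z ^ k = \<chi> h' * z ^ l"
      using that by (intro bexI[of _ h] exI[of _ k]) auto
    fix w assume "\<exists>h'\<in>H. \<exists>l. h \<otimes> x [^] k = h' \<otimes> x [^] l \<and> w = \<chi> h' * z ^ l"
    then obtain h' l where "h' \<in> H" "h \<otimes> x [^] k = h' \<otimes> x [^] l" "w = \<chi> h' * z ^ l"
      by (elim bexE exE conjE)
    then show "w = \<chi> h * z ^ k"
      using key[OF that] by metis
  qed
  show thesis
  proof
    show "subgroup H' G" by (rule sub)
    show "H \<subseteq> H'"
    proof
      fix h assume "h \<in> H"
      then show "h \<in> H'"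
        unfolding H'_def by (intro CollectI exI[of _ h] exI[of _ "0::nat"]) simp
    qed
    have x': "x = \<one> \<otimes> x [^] (1::nat)" using x by simp
    then show "x \<in> H'"
      unfolding H'_def by (intro CollectI exI[of _ \<one>] exI[of _ "1::nat"]) simp
    show "\<chi>' x = z" using \<chi>'[of \<one> 1] x' \<chi>_one by simp
    show "\<chi>' h = \<chi> h" if "h \<in> H" for h
      using \<chi>'[OF that, of 0] that by simp
    have "\<chi>' (h \<otimes> x [^] k \<otimes> (h' \<otimes> x [^] l)) = \<chi>' (h \<otimes> x [^] k) * \<chi>' (h' \<otimes> x [^] l)"
      if h: "h \<in> H" "h' \<in> H" for h h' and k l :: nat
    proof -
      have "h \<otimes> x [^] k \<otimes> (h' \<otimes> x [^] l) = (h \<otimes> h') \<otimes> x [^] (k + l)"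
        using h x by (simp add: nat_pow_mult[symmetric] m_ac)
      then show ?thesis using h by (simp add: \<chi>' \<chi>_mult power_add)
    qed
    moreover have "\<chi>' (h \<otimes> x [^] k) \<noteq> 0" if "h \<in> H" for h and k :: nat
      using \<chi>'[OF that] \<chi>_nz[OF that] z_nz by simp
    ultimately show "\<chi>' \<in> hom (G\<lparr>carrier := H'\<rparr>) complex_units"
      unfolding hom_def H'_def by auto
  qed
qed

text \<open>The group of nonzero complex numbers is divisible, so the root required by
  \<open>character_extend_step\<close> always exists and elements can be adjoined one at a time
  until the whole group is reached.\<close>

lemma character_extend:
  assumes fin: "finite (carrier G)" and H: "subgroup H G"
    and \<chi>: "\<chi> \<in> hom (G\<lparr>carrier := H\<rparr>) complex_units"
  shows "\<exists>\<chi>'\<in>characters G. \<forall>h\<in>H. \<chi>' h = \<chi> h"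
  using H \<chi>
proof (induction "card (carrier G) - card H" arbitrary: H \<chi> rule: less_induct)
  case less
  interpret H: subgroup H G by fact
  show ?case
  proof (cases "H = carrier G")
    case True
    then have "restrict \<chi> (carrier G) \<in> characters G"
      using less.prems(2) by (auto simp: characters_def hom_def)
    then show ?thesis using True by (intro bexI[of _ "restrict \<chi> (carrier G)"]) auto
  next
    case False
    then obtain x where x: "x \<in> carrier G" "x \<notin> H" using H.subset by blast
    obtain n :: nat where n: "n > 0" "x [^] n \<in> H" "\<And>k::nat. x [^] k \<in> H \<Longrightarrow> n dvd k"
      by (rule ex_order_mod_subgroup[OF fin less.prems(1) x(1)]) (rule that)
    obtain z where z: "z ^ n = \<chi> (x [^] n)" using ex_complex_nth_root[OF n(1)] by blast
    obtain H' \<chi>' where H': "subgroup H' G" "H \<subseteq> H'" "x \<in> H'"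
      "\<chi>' \<in> hom (G\<lparr>carrier := H'\<rparr>) complex_units" "\<And>h. h \<in> H \<Longrightarrow> \<chi>' h = \<chi> h"
      by (rule character_extend_step[OF fin less.prems x(1) n(1,2) _ z]) (erule n(3), rule that)
    have "card H < card H'"
      using H'(2,3) x(2) finite_subset[OF subgroup.subset[OF H'(1)] fin]
      by (intro psubset_card_mono) auto
    moreover have "card H' \<le> card (carrier G)"
      using H'(1) fin by (simp add: card_mono subgroup.subset)
    ultimately have "card (carrier G) - card H' < card (carrier G) - card H" by simp
    from less.hyps[OF this H'(1,4)] obtain \<psi> where "\<psi> \<in> characters G" "\<forall>h\<in>H'. \<psi> h = \<chi>' h"
      by blast
    then show ?thesis using H'(2,5) by (intro bexI[of _ \<psi>]) auto
  qed
qed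

text \<open>Modulo \<open>H\<close> the element \<open>x\<close> has order \<open>n > 1\<close>.
  This leaves room to send it to a nontrivial \<open>n\<close>-th root of unity when the trivial
  character of \<open>H\<close> is extended.\<close>

lemma character_separates:
  assumes fin: "finite (carrier G)" and H: "subgroup H G" and x: "x \<in> carrier G" "x \<notin> H"
  obtains \<chi> where "\<chi> \<in> characters G" "\<And>h. h \<in> H \<Longrightarrow> \<chi> h = 1" "\<chi> x \<noteq> 1"
proof -
  interpret H: subgroup H G by fact
  obtain n :: nat where n: "n > 0" "x [^] n \<in> H" "\<And>k::nat. x [^] k \<in> H \<Longrightarrow> n dvd k"
    by (rule ex_order_mod_subgroup[OF fin H x(1)]) (rule that)
  have "n \<noteq> 1" using n(2) x by auto
  then obtain z :: complex where z: "z ^ n = 1" "z \<noteq> 1"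
    using ex_nontrivial_root_of_unity[of n] n(1) by auto
  have triv: "(\<lambda>_. 1) \<in> hom (G\<lparr>carrier := H\<rparr>) complex_units"
    by (simp add: hom_def)
  obtain H' \<chi>' where H': "subgroup H' G" "H \<subseteq> H'" "x \<in> H'"
    "\<chi>' \<in> hom (G\<lparr>carrier := H'\<rparr>) complex_units" "\<And>h. h \<in> H \<Longrightarrow> \<chi>' h = 1" "\<chi>' x = z"
    by (rule character_extend_step[OF fin H triv x(1) n(1,2) _ z(1)]) (erule n(3), rule that)
  then obtain \<chi> where "\<chi> \<in> characters G" "\<forall>h\<in>H'. \<chi> h = \<chi>' h"
    using character_extend[OF fin] by blast
  with H' z(2) show thesis by (intro that[of \<chi>]) auto
qed

section \<open>Orthogonality relations\<close>

lemma character_mult: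
  "\<chi> \<in> characters G \<Longrightarrow> a \<in> carrier G \<Longrightarrow> b \<in> carrier G \<Longrightarrow> \<chi> (a \<otimes> b) = \<chi> a * \<chi> b"
  by (auto simp: characters_def hom_def)

lemma character_nonzero: "\<chi> \<in> characters G \<Longrightarrow> a \<in> carrier G \<Longrightarrow> \<chi> a \<noteq> 0"
  by (auto simp: characters_def hom_def)

lemma character_one: "\<chi> \<in> characters G \<Longrightarrow> \<chi> \<one> = 1"
  using character_mult[of \<chi> \<one> \<one>] character_nonzero[of \<chi> \<one>] by simp

lemma character_pow:
  "\<chi> \<in> characters G \<Longrightarrow> a \<in> carrier G \<Longrightarrow> \<chi> (a [^] (k::nat)) = \<chi> a ^ k"
  by (induction k) (auto simp: character_one character_mult)

lemma characters_eqI: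
  "\<chi> \<in> characters G \<Longrightarrow> \<psi> \<in> characters G \<Longrightarrow> (\<And>a. a \<in> carrier G \<Longrightarrow> \<chi> a = \<psi> a) \<Longrightarrow> \<chi> = \<psi>"
  by (auto simp: characters_def intro: extensionalityI)

lemma finite_characters:
  assumes fin: "finite (carrier G)"
  shows "finite (characters G)"
proof (rule finite_subset)
  show "characters G \<subseteq> PiE (carrier G) (\<lambda>_. {z. z ^ order G = 1})"
  proof
    fix \<chi> assume \<chi>: "\<chi> \<in> characters G"
    have "\<chi> a ^ order G = 1" if "a \<in> carrier G" for a
      using character_pow[OF \<chi> that, of "order G"] that pow_order_eq_1 character_one[OF \<chi>] by simp
    then show "\<chi> \<in> PiE (carrier G) (\<lambda>_. {z. z ^ order G = 1})"
      using \<chi> by (auto simp: characters_def extensional_def)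
  qed
  show "finite (PiE (carrier G) (\<lambda>_. {z::complex. z ^ order G = 1}))"
    using fin order_gt_0_iff_finite by (intro finite_PiE finite_roots_unity) auto
qed

lemma sum_translate:
  assumes "g \<in> carrier G"
  shows "(\<Sum>a\<in>carrier G. f (g \<otimes> a)) = (\<Sum>a\<in>carrier G. f a)"
proof (rule sum.reindex_bij_witness[where i = "\<lambda>a. inv g \<otimes> a" and j = "\<lambda>a. g \<otimes> a"])
qed (use assms in \<open>auto simp flip: m_assoc\<close>)

lemma sum_character:
  assumes \<chi>: "\<chi> \<in> characters G"
  shows "(\<Sum>a\<in>carrier G. \<chi> a) = (if \<forall>a\<in>carrier G. \<chi> a = 1 then of_nat (order G) else 0)"
proof (cases "\<forall>a\<in>carrier G. \<chi> a = 1")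
  case False
  then obtain g where g: "g \<in> carrier G" "\<chi> g \<noteq> 1" by blast
  have "(\<Sum>a\<in>carrier G. \<chi> a) = (\<Sum>a\<in>carrier G. \<chi> (g \<otimes> a))"
    using sum_translate[OF g(1)] by metis
  also have "\<dots> = \<chi> g * (\<Sum>a\<in>carrier G. \<chi> a)"
    using g(1) \<chi> by (simp add: character_mult sum_distrib_left)
  finally show ?thesis using g(2) False by auto
qed (auto simp: order_def)

lemma character_orthogonality:
  assumes \<chi>: "\<chi> \<in> characters G" and \<psi>: "\<psi> \<in> characters G"
  shows "(\<Sum>a\<in>carrier G. \<chi> a * inverse (\<psi> a)) = (if \<chi> = \<psi> then of_nat (order G) else 0)"
proof -
  define \<eta> where "\<eta> = (\<lambda>a\<in>carrier G. \<chi> a * inverse (\<psi> a))"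
  have \<eta>: "\<eta> \<in> characters G"
    using \<chi> \<psi> by (auto simp: \<eta>_def characters_def hom_def)
  have "(\<forall>a\<in>carrier G. \<eta> a = 1) \<longleftrightarrow> (\<forall>a\<in>carrier G. \<chi> a = \<psi> a)"
    using character_nonzero[OF \<psi>] by (auto simp: \<eta>_def field_simps)
  also have "\<dots> \<longleftrightarrow> \<chi> = \<psi>" using characters_eqI[OF \<chi> \<psi>] by blast
  finally show ?thesis using sum_character[OF \<eta>] by (simp add: \<eta>_def)
qed

text \<open>The dual group of G/H, kept inside the characters of G.\<close>

definition annihilator :: "'a set \<Rightarrow> ('a \<Rightarrow> complex) set" where
  "annihilator H = {\<chi> \<in> characters G. \<forall>h\<in>H. \<chi> h = 1}"

text \<open>Off \<open>H\<close>, multiplication by a separating \<open>\<psi>\<close> permutes the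
  annihilator and scales the sum by \<open>\<psi> b\<close>, which is not 1, so the sum vanishes. On
  \<open>H\<close> the sum is the size of the annihilator, which remains to be found.\<close>

lemma sum_annihilator:
  assumes fin: "finite (carrier G)" and H: "subgroup H G" and b: "b \<in> carrier G"
  shows "(\<Sum>\<chi>\<in>annihilator H. \<chi> b) = (if b \<in> H then of_nat (card (lcosets H)) else (0::complex))"
proof -
  interpret H: subgroup H G by fact
  have finA: "finite (annihilator H)"
    using finite_characters[OF fin] by (simp add: annihilator_def)
  have sum_eq: "(\<Sum>\<chi>\<in>annihilator H. \<chi> b) = (if b \<in> H then of_nat (card (annihilator H)) else (0::complex))"
    if b: "b \<in> carrier G" for b
  proof (cases "b \<in> H")
    case False
    obtain \<psi> where \<psi>: "\<psi> \<in> characters G" "\<And>h. h \<in> H \<Longrightarrow> \<psi> h = 1" "\<psi> b \<noteq> 1"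
      using character_separates[OF fin H b False] by blast
    define t where "t \<chi> = (\<lambda>a\<in>carrier G. \<psi> a * \<chi> a)" for \<chi>
    define s where "s \<chi> = (\<lambda>a\<in>carrier G. inverse (\<psi> a) * \<chi> a)" for \<chi>
    have "(\<Sum>\<chi>\<in>annihilator H. \<chi> b) = (\<Sum>\<chi>\<in>annihilator H. t \<chi> b)"
    proof (rule sum.reindex_bij_witness[where i = t and j = s])
      show "t \<chi> \<in> annihilator H" if "\<chi> \<in> annihilator H" for \<chi>
        using that \<psi> by (auto simp: annihilator_def t_def characters_def hom_def)
      show "s \<chi> \<in> annihilator H" if "\<chi> \<in> annihilator H" for \<chi>
        using that \<psi> by (auto simp: annihilator_def s_def characters_def hom_def)
      show ts: "t (s \<chi>) = \<chi>" if "\<chi> \<in> annihilator H" for \<chi>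
        using that character_nonzero[OF \<psi>(1)]
        by (auto simp: annihilator_def t_def s_def characters_def extensional_def restrict_def fun_eq_iff)
      show "s (t \<chi>) = \<chi>" if "\<chi> \<in> annihilator H" for \<chi>
        using that character_nonzero[OF \<psi>(1)]
        by (auto simp: annihilator_def t_def s_def characters_def extensional_def restrict_def fun_eq_iff)
      show "t (s \<chi>) b = \<chi> b" if "\<chi> \<in> annihilator H" for \<chi>
        using ts[OF that] by simp
    qed
    also have "\<dots> = \<psi> b * (\<Sum>\<chi>\<in>annihilator H. \<chi> b)"
      using b by (simp add: t_def sum_distrib_left)
    finally show ?thesis using \<psi>(3) False by auto
  qed (auto simp: annihilator_def)
  define \<tau> where "\<tau> = (\<lambda>a\<in>carrier G. 1::complex)"
  have \<tau>: "\<tau> \<in> annihilator H"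
    by (auto simp: annihilator_def \<tau>_def characters_def hom_def)
  \<comment> \<open>Double counting: summing over characters first leaves the elements of
    \<open>H\<close>; summing over elements first leaves the trivial character
    \<open>\<tau>\<close>. Lagrange then turns the size of the annihilator into the index.\<close>
  have "(\<Sum>b\<in>carrier G. \<Sum>\<chi>\<in>annihilator H. \<chi> b)
      = (\<Sum>b\<in>carrier G. if b \<in> H then of_nat (card (annihilator H)) else 0)"
    by (intro sum.cong refl sum_eq)
  also have "\<dots> = of_nat (card H * card (annihilator H))"
    using fin H.subset by (simp add: sum.If_cases Int_absorb1)
  finally have "of_nat (card H * card (annihilator H)) = (\<Sum>\<chi>\<in>annihilator H. \<Sum>b\<in>carrier G. \<chi> b)"
    by (subst sum.swap) simp
  also have "\<dots> = (\<Sum>\<chi>\<in>annihilator H. if \<chi> = \<tau> then of_nat (order G) else 0)"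
  proof (intro sum.cong refl)
    fix \<chi> assume "\<chi> \<in> annihilator H"
    then have \<chi>: "\<chi> \<in> characters G" by (simp add: annihilator_def)
    have "(\<forall>a\<in>carrier G. \<chi> a = 1) \<longleftrightarrow> \<chi> = \<tau>"
      using characters_eqI[OF \<chi>, of \<tau>] \<tau> by (auto simp: \<tau>_def annihilator_def)
    then show "(\<Sum>b\<in>carrier G. \<chi> b) = (if \<chi> = \<tau> then of_nat (order G) else 0)"
      using sum_character[OF \<chi>] by simp
  qed
  also have "\<dots> = of_nat (order G)"
    using finA \<tau> by simp
  finally have "card H * card (annihilator H) = order G"
    using of_nat_eq_iff by blast
  then have "card (annihilator H) = card (lcosets H)"
    using l_lagrange[OF fin H] H.finite_imp_card_positive[OF fin]
    by (metis mult.commute mult_cancel2 less_irrefl)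
  then show ?thesis using sum_eq[OF b] by simp
qed

text \<open>This finds a generator of \<langle>a, b\<rangle> in the coset of b modulo
  \<langle>a\<rangle>. With a = g^i and b = g^j its exponent is j + k i, and it suffices that the
  gcd of this exponent with the order of g divides gcd i j.\<close>

lemma cyclic_pair_generator:
  assumes fin: "finite (carrier G)" and g: "g \<in> carrier G"
    and a: "a \<in> generate G {g}" and b: "b \<in> generate G {g}"
  obtains k :: nat where "a \<in> generate G {b \<otimes> a [^] k}" "b \<in> generate G {b \<otimes> a [^] k}"
proof -
  obtain i j :: nat where ij: "a = g [^] i" "b = g [^] j"
    using a b generate_pow_on_finite_carrier[OF fin g] by auto
  \<comment> \<open>If both exponents are 0, any \<open>k\<close> will do. Otherwise dividing by
    \<open>d\<close> makes them coprime, and \<open>k\<close> is chosen to make the reduced exponent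
    coprime to the order of \<open>g\<close>.\<close>
  obtain k where k: "gcd (j + k * i) (ord g) dvd gcd i j"
  proof (cases "gcd i j = 0")
    case False
    define d where "d = gcd i j"
    obtain i' j' where d: "i = d * i'" "j = d * j'" "coprime i' j'"
      using gcd_coprime_exists[OF False] unfolding d_def by (metis mult.commute)
    obtain k where k: "coprime (j' + k * i') (ord g)"
      using coprime_add_mult_ex[OF d(3)] ord_ge_1[OF fin g] by (metis less_le_trans zero_less_one)
    have "j + k * i = d * (j' + k * i')"
      by (simp add: d algebra_simps)
    then have "gcd (j + k * i) (ord g) = gcd d (ord g)"
      using k by (simp add: coprime_commute gcd_mult_left_right_cancel)
    then have "gcd (j + k * i) (ord g) dvd gcd i j"
      unfolding d_def by (metis gcd_dvd1)
    then show thesis by (rule that)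
  qed (use that in auto)
  define c where "c = j + k * i"
  have c: "b \<otimes> a [^] k = g [^] c"
    using g by (simp add: ij c_def nat_pow_pow nat_pow_mult mult.commute)
  \<comment> \<open>By Bezout, a multiple of the gcd is a multiple of \<open>c\<close> modulo the
    order of \<open>g\<close>.\<close>
  have "g [^] m \<in> generate G {g [^] c}" if m: "gcd c (ord g) dvd m" for m :: nat
  proof -
    obtain q where q: "m = gcd c (ord g) * q" using m by auto
    obtain u v where uv: "u * int c + v * int (ord g) = int (gcd c (ord g))"
      using bezout_int[of "int c" "int (ord g)"] by auto
    have "g [^] m = g [^] (int m)" by (simp add: int_pow_int)
    also have "int m = int c * (u * int q) + int (ord g) * (v * int q)"
      using uv by (simp add: q flip: uv) (simp add: algebra_simps)
    also have "g [^] \<dots> = (g [^] c) [^] (u * int q)"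
      using g by (simp add: int_pow_mult int_pow_pow[symmetric] int_pow_int int_pow_one)
    finally show ?thesis using generate_pow[of "g [^] c"] g by auto
  qed
  then have "a \<in> generate G {b \<otimes> a [^] k}" "b \<in> generate G {b \<otimes> a [^] k}"
    using k unfolding c unfolding ij c_def by auto
  then show thesis using that by blast
qed

end

section \<open>Multiplicities of coset WPAs\<close>

context completely_degenerate_quadratic_group
begin

lemma theta_nonzero: "a \<in> carrier G \<Longrightarrow> \<theta> a \<noteq> 0"
  using theta_closed by auto

lemma theta_one: "\<theta> \<one> = 1"
  using theta_mult[of \<one> \<one>] theta_nonzero[of \<one>] by simp

text \<open>The exponent \<open>n\<^sup>2\<close> is 1 at n = -1, so inversion leaves
  \<open>\<theta>\<close> unchanged; multiplicativity does the rest.\<close>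

lemma theta_square: assumes a: "a \<in> carrier G" shows "\<theta> a * \<theta> a = 1"
proof -
  have "\<theta> (inv a) = \<theta> a"
    using theta_int_pow[OF a, of "-1"] a int_pow_neg[OF a, of 1] by simp
  then show ?thesis
    using theta_mult[OF inv_closed[OF a] a] a theta_one by simp
qed

lemma theta_cases: "a \<in> carrier G \<Longrightarrow> \<theta> a = 1 \<or> \<theta> a = -1"
  using theta_square[of a] by (simp add: square_eq_1_iff)

text \<open>Members of \<open>characters\<close> are extensional, so \<open>\<theta>\<close> must be
  cut off outside the group before it can index a summand.\<close>

abbreviation \<theta>' :: "'a \<Rightarrow> complex" where
  "\<theta>' \<equiv> restrict \<theta> (carrier G)"

abbreviation even_part :: "'a set \<Rightarrow> 'a set" where
  "even_part K \<equiv> {k \<in> K. \<theta> k = 1}"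

abbreviation theta_extensions :: "'a set \<Rightarrow> ('a \<Rightarrow> complex) set" where
  "theta_extensions K \<equiv> {\<xi> \<in> characters G. \<forall>k\<in>K. \<xi> k = \<theta> k}"

abbreviation subgroup_index :: "'a set \<Rightarrow> complex" where
  "subgroup_index H \<equiv> of_nat (card (lcosets H))"

lemma theta'_character: "\<theta>' \<in> characters G"
  using theta_nonzero by (auto simp: characters_def hom_def theta_mult)

lemma theta'_extension: "subgroup K G \<Longrightarrow> \<theta>' \<in> theta_extensions K"
  using theta'_character by (auto dest: subgroup.mem_carrier)

text \<open>Since \<open>\<theta>\<close> is its own inverse, the kernel condition on the product
  says that the two characters agree on \<open>H\<close>.\<close>

lemma coset_params_iff:
  "(H, \<xi>) \<in> coset_params G \<theta> \<longleftrightarrow> subgroup H G \<and> \<xi> \<in> theta_extensions H"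
proof -
  have "H \<subseteq> kernel G complex_units (\<lambda>a. \<xi> a * \<theta> a) \<longleftrightarrow> (\<forall>k\<in>H. \<xi> k = \<theta> k)" if H: "subgroup H G"
  proof -
    have "\<xi> k * \<theta> k = 1 \<longleftrightarrow> \<xi> k = \<theta> k" if "k \<in> H" for k
      using theta_cases[OF subgroup.mem_carrier[OF H that]] by auto (metis minus_minus)
    then show ?thesis
      using subgroup.subset[OF H] by (auto simp: kernel_def)
  qed
  then show ?thesis by (auto simp: coset_params_def)
qed

lemma finite_coset_params: "finite (coset_params G \<theta>)"
  by (rule finite_subset[of _ "Pow (carrier G) \<times> characters G"])
    (use finite_carrier finite_characters in \<open>auto simp: coset_params_iff dest: subgroup.mem_carrier\<close>)

section \<open>The index sets of \<open>\<A>[K]\<close> and the even part of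
  \<open>K\<close>\<close>

lemma subgroup_even_part: assumes "subgroup K G" shows "subgroup (even_part K) G"
proof -
  interpret K: subgroup K G by fact
  have "\<theta> (inv k) = 1" if "k \<in> K" "\<theta> k = 1" for k
    using theta_mult[of "inv k" k] that theta_one by simp
  then show ?thesis
    by (intro subgroup.intro) (auto simp: theta_mult theta_one)
qed

text \<open>The case distinction disappears in a union of sets: if \<open>\<theta>\<close> is
  trivial on \<open>K\<close>, the two products coincide and count once.\<close>

lemma admissible_coset_params_eq:
  assumes K: "subgroup K G"
  shows "admissible_coset_params G \<theta> K
    = {K} \<times> theta_extensions K \<union> {even_part K} \<times> annihilator K"
proof -
  have e: "K \<inter> kernel G complex_units \<theta> = even_part K"
    using subgroup.subset[OF K] by (auto simp: kernel_def)
  have 1: "K \<subseteq> kernel G complex_units (\<lambda>a. \<theta> a * \<phi> a) \<longleftrightarrow> (\<forall>k\<in>K. \<phi> k = \<theta> k)" for \<phi>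
  proof -
    have "\<theta> k * \<phi> k = 1 \<longleftrightarrow> \<phi> k = \<theta> k" if "k \<in> K" for k
      using theta_cases[OF subgroup.mem_carrier[OF K that]] by auto (metis minus_minus)
    then show ?thesis
      using subgroup.subset[OF K] by (auto simp: kernel_def)
  qed
  have 2: "K \<subseteq> kernel G complex_units \<phi> \<longleftrightarrow> (\<forall>k\<in>K. \<phi> k = 1)" for \<phi>
    using subgroup.subset[OF K] by (auto simp: kernel_def)
  have 3: "theta_extensions K = annihilator K" if "K = even_part K"
    using that by (auto simp: annihilator_def)
  show ?thesis
  proof (cases "K = even_part K")
    case True
    then have "admissible_coset_params G \<theta> K = {K} \<times> annihilator K"
      unfolding admissible_coset_params_def Let_def e 2 by (auto simp: annihilator_def)
    then show ?thesis using 3[OF True] True[symmetric] by simp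
  next
    case False
    then show ?thesis
      unfolding admissible_coset_params_def Let_def e 1 2 by (auto simp: annihilator_def)
  qed
qed

lemma admissible_coset_params_subset:
  assumes K: "subgroup K G"
  shows "admissible_coset_params G \<theta> K \<subseteq> coset_params G \<theta>"
  using subgroup_even_part[OF K] K
  by (auto simp: admissible_coset_params_eq coset_params_iff annihilator_def)

text \<open>If \<open>\<theta>'\<close> annihilates \<open>K\<close>, then \<open>K\<close> is its
  own even part, so the second family too can only give \<open>K\<close>. Thus the multiplicity at
  \<open>\<theta>'\<close> detects a single \<open>\<A>[K]\<close>.\<close>

lemma theta'_admissible_coset_params:
  assumes K: "subgroup K G"
  shows "(H, \<theta>') \<in> admissible_coset_params G \<theta> K \<longleftrightarrow> H = K"
proof -
  have "even_part K = K" if "\<theta>' \<in> annihilator K"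
    using that by (auto simp: annihilator_def subgroup.mem_carrier[OF K])
  then show ?thesis
    using theta'_extension[OF K] by (auto simp: admissible_coset_params_eq[OF K])
qed

text \<open>Multiplication by \<open>\<theta>\<close> is an involution that exchanges these
  characters with the annihilator of \<open>K\<close>.\<close>

lemma sum_theta_extensions:
  assumes K: "subgroup K G" and b: "b \<in> carrier G"
  shows "(\<Sum>\<xi>\<in>theta_extensions K. \<xi> b) = (if b \<in> K then \<theta> b * subgroup_index K else 0)"
proof -
  define t where "t \<xi> = (\<lambda>a\<in>carrier G. \<theta> a * \<xi> a)" for \<xi>
  have t_char: "t \<xi> \<in> characters G" if "\<xi> \<in> characters G" for \<xi>
    using that theta_nonzero by (auto simp: t_def characters_def hom_def theta_mult)
  have tt: "t (t \<xi>) = \<xi>" if "\<xi> \<in> characters G" for \<xi>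
    using that theta_square
    by (intro characters_eqI t_char) (auto simp: t_def mult.assoc[symmetric])
  have "(\<Sum>\<xi>\<in>theta_extensions K. \<xi> b) = (\<Sum>\<xi>\<in>annihilator K. t \<xi> b)"
  proof (rule sum.reindex_bij_witness[where i = t and j = t])
    show "t \<xi> \<in> annihilator K" if "\<xi> \<in> theta_extensions K" for \<xi>
      using that t_char theta_square subgroup.subset[OF K] by (auto simp: annihilator_def t_def)
    show "t \<xi> \<in> theta_extensions K" if "\<xi> \<in> annihilator K" for \<xi>
      using that t_char theta_square subgroup.subset[OF K] by (auto simp: annihilator_def t_def)
  qed (use tt in \<open>auto simp: annihilator_def\<close>)
  also have "\<dots> = \<theta> b * (\<Sum>\<xi>\<in>annihilator K. \<xi> b)"
    using b by (simp add: t_def sum_distrib_left)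
  finally show ?thesis
    using sum_annihilator[OF finite_carrier K b] by simp
qed

text \<open>Translation by an element of sign -1 exchanges the even part with its complement in
  \<open>K\<close>, so the even part has index 2 in \<open>K\<close>.\<close>

lemma subgroup_index_even_part:
  assumes K: "subgroup K G" and ne: "even_part K \<noteq> K"
  shows "subgroup_index (even_part K) = 2 * subgroup_index K"
proof -
  interpret K: subgroup K G by fact
  obtain g where g: "g \<in> K" "\<theta> g \<noteq> 1" using ne by blast
  then have \<theta>g: "\<theta> g = -1" using theta_cases[of g] by simp
  have inv: "\<theta> (inv g) = -1"
    using theta_mult[of "inv g" g] theta_cases[of "inv g"] g(1) \<theta>g theta_one by auto
  have "bij_betw (\<lambda>k. g \<otimes> k) (even_part K) (K - even_part K)"
  proof (rule bij_betw_byWitness[where f' = "\<lambda>k. inv g \<otimes> k"])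
    show "\<forall>k\<in>even_part K. inv g \<otimes> (g \<otimes> k) = k"
      using g(1) by (auto simp flip: m_assoc)
    show "\<forall>k\<in>K - even_part K. g \<otimes> (inv g \<otimes> k) = k"
      using g(1) by (auto simp flip: m_assoc)
    show "(\<lambda>k. g \<otimes> k) ` even_part K \<subseteq> K - even_part K"
      using g(1) \<theta>g by (auto simp: theta_mult)
    show "(\<lambda>k. inv g \<otimes> k) ` (K - even_part K) \<subseteq> even_part K"
    proof (rule image_subsetI)
      fix k assume k: "k \<in> K - even_part K"
      then have "\<theta> k = -1" using theta_cases[of k] by auto
      then show "inv g \<otimes> k \<in> even_part K" using k g(1) inv by (simp add: theta_mult)
    qed
  qed
  then have "card (even_part K) = card (K - even_part K)"
    by (rule bij_betw_same_card)
  moreover have finK: "finite K"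
    using finite_subset[OF K.subset finite_carrier] .
  ultimately have "card K = 2 * card (even_part K)"
    using card_Diff_subset[of "even_part K" K] card_mono[of K "even_part K"] by force
  moreover have "card (lcosets K) * card K = card (lcosets (even_part K)) * card (even_part K)"
    using l_lagrange[OF finite_carrier] K subgroup_even_part[OF K] by simp
  moreover have "card (even_part K) > 0"
    using subgroup.finite_imp_card_positive[OF subgroup_even_part[OF K] finite_carrier] .
  ultimately have "card (lcosets (even_part K)) * card (even_part K)
      = 2 * card (lcosets K) * card (even_part K)" "card (even_part K) \<noteq> 0"
    by simp_all
  then have "card (lcosets (even_part K)) = 2 * card (lcosets K)"
    by (simp only: mult_cancel2) simp
  then show ?thesis by simp
qed

text \<open>The value of \<open>\<Upsilon>\<close> on a sum of coset WPAs with multiplicities \<open>m\<close>.\<close>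

definition multiplicity_Upsilon ::
    "('a set \<times> ('a \<Rightarrow> complex) \<Rightarrow> complex) \<Rightarrow> 'a \<Rightarrow> 'a \<Rightarrow> complex" where
  "multiplicity_Upsilon m a b =
     (\<Sum>(H, \<xi>)\<in>coset_params G \<theta>. m (H, \<xi>) * (if a \<in> H then subgroup_index H * \<xi> b else 0))"

text \<open>If the even part is proper, the first family contributes the term
  \<open>\<theta> b\<close>. The second contributes only when \<open>a\<close> is in the even part,
  and its 2 is the doubled index of \<open>even_part K\<close>.\<close>

lemma admissible_coset_Upsilon:
  assumes K: "subgroup K G" and a: "a \<in> carrier G" and b: "b \<in> carrier G"
  shows "(\<Sum>(H, \<xi>)\<in>admissible_coset_params G \<theta> K. if a \<in> H then subgroup_index H * \<xi> b else 0)
    = (if a \<in> K \<and> b \<in> K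
       then (subgroup_index K)\<^sup>2 * (if even_part K = K then 1 else if \<theta> a = 1 then 2 + \<theta> b else \<theta> b)
       else 0)" (is "?S = _")
proof -
  have fin: "finite (theta_extensions K)" "finite (annihilator K)"
    using finite_characters[OF finite_carrier] by (auto simp: annihilator_def)
  have single: "(\<Sum>(H, \<xi>)\<in>{L} \<times> Y. if a \<in> H then subgroup_index H * \<xi> b else 0)
      = (if a \<in> L then subgroup_index L * (\<Sum>\<xi>\<in>Y. \<xi> b) else 0)" for L and Y :: "('a \<Rightarrow> complex) set"
    by (simp add: sum.cartesian_product[symmetric] sum_distrib_left)
  show ?thesis
  proof (cases "even_part K = K")
    case True
    then have "theta_extensions K = annihilator K" by (auto simp: annihilator_def)
    then have "?S = (if a \<in> K then subgroup_index K * (\<Sum>\<xi>\<in>annihilator K. \<xi> b) else 0)"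
      using single[of K "annihilator K"] True by (simp add: admissible_coset_params_eq[OF K])
    then show ?thesis
      using sum_annihilator[OF finite_carrier K b] True by (simp add: power2_eq_square)
  next
    case False
    have "?S = (\<Sum>(H, \<xi>)\<in>{K} \<times> theta_extensions K. if a \<in> H then subgroup_index H * \<xi> b else 0)
        + (\<Sum>(H, \<xi>)\<in>{even_part K} \<times> annihilator K. if a \<in> H then subgroup_index H * \<xi> b else 0)"
      unfolding admissible_coset_params_eq[OF K] using fin False
      by (intro sum.union_disjoint finite_cartesian_product) auto
    then show ?thesis
      unfolding single sum_annihilator[OF finite_carrier K b] sum_theta_extensions[OF K b]
        subgroup_index_even_part[OF K False]
      using False by (simp add: power2_eq_square algebra_simps)
  qed
qed

text \<open>For a proper even part the factor is 3 at signs (1, 1) and -1 at (-1, -1); at (1, -1) it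
  is 2 - 1, which equals the 1 at (-1, 1). The second family of \<open>\<A>[K]\<close> serves to
  produce this balance.\<close>

lemma admissible_coset_Upsilon_sym:
  assumes K: "subgroup K G" and a: "a \<in> carrier G" and b: "b \<in> carrier G"
  shows "(\<Sum>(H, \<xi>)\<in>admissible_coset_params G \<theta> K. if a \<in> H then subgroup_index H * \<xi> b else 0)
    = (\<Sum>(H, \<xi>)\<in>admissible_coset_params G \<theta> K. if b \<in> H then subgroup_index H * \<xi> a else 0)"
  unfolding admissible_coset_Upsilon[OF assms] admissible_coset_Upsilon[OF K b a]
  using theta_cases[OF a] theta_cases[OF b] by auto

lemma multiplicity_Upsilon_sum:
  assumes fin: "finite A" and K: "\<And>\<alpha>. \<alpha> \<in> A \<Longrightarrow> subgroup (K \<alpha>) G"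
  shows "multiplicity_Upsilon (\<lambda>x. \<Sum>\<alpha>\<in>A. if x \<in> admissible_coset_params G \<theta> (K \<alpha>) then n \<alpha> else 0) a b
    = (\<Sum>\<alpha>\<in>A. n \<alpha> * (\<Sum>(H, \<xi>)\<in>admissible_coset_params G \<theta> (K \<alpha>).
         if a \<in> H then subgroup_index H * \<xi> b else 0))"
proof -
  define u :: "'a set \<times> ('a \<Rightarrow> complex) \<Rightarrow> complex"
    where "u = (\<lambda>(H, \<xi>). if a \<in> H then subgroup_index H * \<xi> b else 0)"
  let ?P = "coset_params G \<theta>" and ?Q = "\<lambda>\<alpha>. admissible_coset_params G \<theta> (K \<alpha>)"
  have "multiplicity_Upsilon (\<lambda>x. \<Sum>\<alpha>\<in>A. if x \<in> ?Q \<alpha> then n \<alpha> else 0) a b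
      = (\<Sum>x\<in>?P. \<Sum>\<alpha>\<in>A. (if x \<in> ?Q \<alpha> then n \<alpha> * u x else 0))"
    unfolding multiplicity_Upsilon_def u_def
    by (intro sum.cong refl) (auto simp: sum_distrib_right intro!: sum.cong)
  also have "\<dots> = (\<Sum>\<alpha>\<in>A. \<Sum>x\<in>?P. (if x \<in> ?Q \<alpha> then n \<alpha> * u x else 0))"
    by (rule sum.swap)
  also have "\<dots> = (\<Sum>\<alpha>\<in>A. \<Sum>x\<in>?Q \<alpha>. n \<alpha> * u x)"
  proof (rule sum.cong[OF refl])
    fix \<alpha> assume "\<alpha> \<in> A"
    then have "?Q \<alpha> \<subseteq> ?P" using admissible_coset_params_subset K by blast
    then show "(\<Sum>x\<in>?P. (if x \<in> ?Q \<alpha> then n \<alpha> * u x else 0)) = (\<Sum>x\<in>?Q \<alpha>. n \<alpha> * u x)"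
      using finite_coset_params by (intro sum.mono_neutral_cong_right) auto
  qed
  finally show ?thesis by (simp add: u_def sum_distrib_left)
qed

text \<open>The key step: in a symmetric \<open>\<Upsilon>\<close> that vanishes on all pairs outside a common cyclic
  subgroup, the part at \<open>H = \<langle>a\<rangle>\<close> vanishes off \<open>H\<close> once the larger subgroups have been dealt with,
  because \<open>b\<close> may be moved by an element of \<open>H\<close> to a generator of \<open>\<langle>a, b\<rangle>\<close>. By Fourier inversion
  the multiplicities at \<open>H\<close> are then all equal to the one at \<open>\<theta>\<close>.\<close>

lemma multiplicities_eq_zero:
  fixes d :: "'a set \<times> ('a \<Rightarrow> complex) \<Rightarrow> complex"
  assumes noncyclic: "\<And>H \<xi>. (H, \<xi>) \<in> coset_params G \<theta> \<Longrightarrow> \<nexists>g. g \<in> carrier G \<and> H = generate G {g} \<Longrightarrow> d (H, \<xi>) = 0"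
    and at_theta: "\<And>H. subgroup H G \<Longrightarrow> d (H, \<theta>') = 0"
    and sym: "\<And>a b. a \<in> carrier G \<Longrightarrow> b \<in> carrier G \<Longrightarrow> multiplicity_Upsilon d a b = multiplicity_Upsilon d b a"
    and vanish: "\<And>a b. a \<in> carrier G \<Longrightarrow> b \<in> carrier G \<Longrightarrow>
      \<nexists>g. g \<in> carrier G \<and> a \<in> generate G {g} \<and> b \<in> generate G {g} \<Longrightarrow> multiplicity_Upsilon d a b = 0"
    and x: "(H, \<xi>) \<in> coset_params G \<theta>"
  shows "d (H, \<xi>) = 0"
  using x
proof (induction "card (carrier G) - card H" arbitrary: H \<xi> rule: less_induct)
  case less
  have H: "subgroup H G" using less.prems by (simp add: coset_params_iff)
  interpret H: subgroup H G by fact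
  show ?case
  proof (cases "\<exists>g. g \<in> carrier G \<and> H = generate G {g}")
    case False
    then show ?thesis using noncyclic less.prems by blast
  next
    case True
    then obtain a where a: "a \<in> carrier G" and Ha: "H = generate G {a}" by blast
    have aH: "a \<in> H" unfolding Ha by (rule generate.incl) simp
    have larger: "d (K, \<psi>) = 0" if K: "(K, \<psi>) \<in> coset_params G \<theta>" and "H \<subset> K" for K \<psi>
    proof (rule less.hyps[OF _ K])
      have KG: "K \<subseteq> carrier G" using K by (auto simp: coset_params_iff dest: subgroup.subset)
      then have "card H < card K"
        using \<open>H \<subset> K\<close> finite_carrier by (meson finite_subset psubset_card_mono)
      moreover have "card K \<le> card (carrier G)" using KG finite_carrier by (rule card_mono[rotated])
      ultimately show "card (carrier G) - card K < card (carrier G) - card H" by simp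
    qed
    have H_le: "H \<subseteq> K" if "(K, \<psi>) \<in> coset_params G \<theta>" "a \<in> K" for K \<psi>
      using that generate_subgroup_incl[of "{a}" K] by (simp add: Ha coset_params_iff)
    define f where "f b = (\<Sum>\<psi>\<in>theta_extensions H. d (H, \<psi>) * \<psi> b)" for b
    \<comment> \<open>Since \<open>a\<close> generates \<open>H\<close>, only subgroups containing
      \<open>H\<close> occur, and the strictly larger ones drop out by induction.\<close>
    have U: "multiplicity_Upsilon d a b = subgroup_index H * f b" for b
    proof -
      have "multiplicity_Upsilon d a b
          = (\<Sum>(K, \<psi>)\<in>{H} \<times> theta_extensions H. d (K, \<psi>) * (subgroup_index K * \<psi> b))"
        unfolding multiplicity_Upsilon_def
      proof (rule sum.mono_neutral_cong_right[OF finite_coset_params])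
        show "{H} \<times> theta_extensions H \<subseteq> coset_params G \<theta>"
          using H by (auto simp: coset_params_iff)
        show "\<forall>x\<in>coset_params G \<theta> - {H} \<times> theta_extensions H.
            (case x of (K, \<psi>) \<Rightarrow> d (K, \<psi>) * (if a \<in> K then subgroup_index K * \<psi> b else 0)) = 0"
        proof
          fix x assume x: "x \<in> coset_params G \<theta> - {H} \<times> theta_extensions H"
          obtain K \<psi> where x_eq: "x = (K, \<psi>)" by fastforce
          have K: "(K, \<psi>) \<in> coset_params G \<theta>" and "K \<noteq> H"
            using x by (auto simp: x_eq coset_params_iff)
          then have "d (K, \<psi>) = 0" if "a \<in> K"
            using larger[OF K] H_le[OF K that] by blast
          then show "(case x of (K, \<psi>) \<Rightarrow> d (K, \<psi>) * (if a \<in> K then subgroup_index K * \<psi> b else 0)) = 0"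
            by (simp add: x_eq)
        qed
      qed (use aH in auto)
      then show ?thesis
        by (simp add: sum.cartesian_product[symmetric] f_def sum_distrib_left mult_ac)
    qed
    have index_nz: "subgroup_index H \<noteq> 0"
      using l_lagrange[OF finite_carrier H] finite_carrier order_gt_0_iff_finite
      by (metis mult_zero_left neq0_conv of_nat_0_eq_iff)
    have f_off: "f b = 0" if b: "b \<in> carrier G" "b \<notin> H" for b
    proof (cases "\<exists>g. g \<in> carrier G \<and> a \<in> generate G {g} \<and> b \<in> generate G {g}")
      case False
      then show ?thesis using vanish[OF a b(1)] U[of b] index_nz by simp
    next
      case True
      then obtain g where g: "g \<in> carrier G" "a \<in> generate G {g}" "b \<in> generate G {g}" by blast
      obtain k :: nat where k: "a \<in> generate G {b \<otimes> a [^] k}" "b \<in> generate G {b \<otimes> a [^] k}"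
        using cyclic_pair_generator[OF finite_carrier g] .
      let ?c = "b \<otimes> a [^] k"
      have c: "?c \<in> carrier G" using a b by simp
      have h: "a [^] k \<in> H" using aH by (induction k) auto
      \<comment> \<open>A subgroup containing \<open>?c\<close> contains \<open>a\<close> and
        \<open>b\<close>, hence is strictly larger than \<open>H\<close>. Symmetry carries the
        vanishing over to \<open>f ?c\<close>.\<close>
      have "multiplicity_Upsilon d ?c a = 0"
        unfolding multiplicity_Upsilon_def
      proof (rule sum.neutral, clarify)
        fix K \<psi> assume K: "(K, \<psi>) \<in> coset_params G \<theta>"
        have "d (K, \<psi>) = 0" if "?c \<in> K"
        proof (rule larger[OF K])
          have "generate G {?c} \<subseteq> K"
            using K that generate_subgroup_incl[of "{?c}" K] by (simp add: coset_params_iff)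
          then have "a \<in> K" "b \<in> K" using k by auto
          then show "H \<subset> K" using H_le[OF K] b(2) by blast
        qed
        then show "d (K, \<psi>) * (if ?c \<in> K then subgroup_index K * \<psi> a else 0) = 0" by simp
      qed
      then have "f ?c = 0"
        using sym[OF a c] U[of ?c] index_nz by simp
      \<comment> \<open>All characters summed in \<open>f\<close> agree with \<open>\<theta>\<close>
        on \<open>H\<close>, so translation by an element of \<open>H\<close> is a common nonzero
        factor.\<close>
      moreover have "f ?c = \<theta> (a [^] k) * f b"
        unfolding f_def sum_distrib_left
        using h b a by (intro sum.cong refl) (auto simp: character_mult)
      ultimately show ?thesis using theta_nonzero[of "a [^] k"] a by simp
    qed
    have f_on: "f b = \<theta> b * f \<one>" if b: "b \<in> H" for b
      unfolding f_def sum_distrib_left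
      using b by (intro sum.cong refl) (auto simp: character_one)
    \<comment> \<open>The right-hand side does not depend on \<open>\<psi>\<close>: the quotient of
      \<open>f\<close> by \<open>\<psi>\<close> is constant on \<open>H\<close> and 0
      elsewhere.\<close>
    have inversion: "of_nat (order G) * d (H, \<psi>) = of_nat (card H) * f \<one>"
      if \<psi>: "\<psi> \<in> theta_extensions H" for \<psi>
    proof -
      have "(\<Sum>b\<in>carrier G. f b * inverse (\<psi> b))
          = (\<Sum>b\<in>carrier G. \<Sum>\<phi>\<in>theta_extensions H. d (H, \<phi>) * (\<phi> b * inverse (\<psi> b)))"
        by (simp add: f_def sum_distrib_right mult.assoc)
      also have "\<dots> = (\<Sum>\<phi>\<in>theta_extensions H. d (H, \<phi>) * (\<Sum>b\<in>carrier G. \<phi> b * inverse (\<psi> b)))"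
        by (subst sum.swap) (simp add: sum_distrib_left)
      also have "\<dots> = (\<Sum>\<phi>\<in>theta_extensions H. if \<phi> = \<psi> then d (H, \<phi>) * of_nat (order G) else 0)"
        using \<psi> by (intro sum.cong refl) (simp add: character_orthogonality)
      also have "\<dots> = of_nat (order G) * d (H, \<psi>)"
        using \<psi> finite_characters[OF finite_carrier] by (simp add: mult.commute)
      finally have "of_nat (order G) * d (H, \<psi>) = (\<Sum>b\<in>carrier G. f b * inverse (\<psi> b))" ..
      also have "\<dots> = (\<Sum>b\<in>H. f \<one>)"
      proof (rule sum.mono_neutral_cong_right[OF finite_carrier H.subset])
        show "\<forall>b\<in>carrier G - H. f b * inverse (\<psi> b) = 0" using f_off by simp
        show "f b * inverse (\<psi> b) = f \<one>" if "b \<in> H" for b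
        proof -
          have "\<psi> b = \<theta> b" using \<psi> that by blast
          then show ?thesis
            using theta_nonzero[OF H.mem_carrier[OF that]] f_on[OF that] by simp
        qed
      qed
      finally show ?thesis by simp
    qed
    have "of_nat (order G) * d (H, \<xi>) = of_nat (order G) * d (H, \<theta>')"
      using inversion[of \<xi>] inversion[OF theta'_extension[OF H]] less.prems
      by (simp add: coset_params_iff)
    then show ?thesis
      using at_theta[OF H] finite_carrier order_gt_0_iff_finite by auto
  qed
qed

text \<open>If the generator has sign -1, its even powers form the even part, which
  \<open>g [^] 2\<close> generates. Hence the second family of
  \<open>\<A>[\<langle>\<alpha>\<rangle>]\<close> also sits on a cyclic subgroup.\<close>

lemma cyclic_even_part:
  assumes g: "g \<in> carrier G"
  shows "\<exists>h. h \<in> carrier G \<and> even_part (generate G {g}) = generate G {h}"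
proof (cases "\<theta> g = 1")
  case True
  have "subgroup {x \<in> carrier G. \<theta> x = 1} G"
    using subgroup_even_part[OF subgroup_self] .
  then have "generate G {g} \<subseteq> {x \<in> carrier G. \<theta> x = 1}"
    using True g by (intro generate_subgroup_incl) auto
  then have "even_part (generate G {g}) = generate G {g}" by auto
  then show ?thesis using g by blast
next
  case False
  then have \<theta>g: "\<theta> g = -1" using theta_cases[OF g] by simp
  have pow: "\<theta> (g [^] k) = (-1) ^ k" for k :: nat
    using character_pow[OF theta'_character g, of k] g \<theta>g by simp
  have "even_part (generate G {g}) = generate G {g [^] (2::nat)}"
    unfolding generate_pow_on_finite_carrier[OF finite_carrier g]
      generate_pow_on_finite_carrier[OF finite_carrier nat_pow_closed[OF g]]
  proof (intro equalityI subsetI)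
    fix y assume "y \<in> even_part {g [^] k |k. k \<in> (UNIV::nat set)}"
    then obtain k :: nat where k: "y = g [^] k" "\<theta> y = 1" by auto
    then have "even k" using pow[of k] by (cases "even k") auto
    then obtain l where "k = 2 * l" by blast
    then have "y = (g [^] (2::nat)) [^] l" using g k(1) by (simp add: nat_pow_pow)
    then show "y \<in> {(g [^] (2::nat)) [^] k |k. k \<in> (UNIV::nat set)}" by blast
  next
    fix y assume "y \<in> {(g [^] (2::nat)) [^] k |k. k \<in> (UNIV::nat set)}"
    then obtain l :: nat where "y = g [^] (2 * l)" using g by (auto simp: nat_pow_pow)
    then show "y \<in> even_part {g [^] k |k. k \<in> (UNIV::nat set)}" using pow by auto
  qed
  then show ?thesis using g by blast
qed

end

section \<open>Weighted permutation actions\<close>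

lemma wpa_equivE:
  assumes "wpa_equiv G \<Phi> \<Psi>"
  obtains f where "bij_betw f (support \<Phi>) (support \<Psi>)"
    "\<And>\<alpha> p. \<alpha> \<in> carrier G \<Longrightarrow> p \<in> support \<Phi> \<Longrightarrow> f (act \<Phi> \<alpha> p) = act \<Psi> \<alpha> (f p)"
    "\<And>B. B \<in> orbits G (support \<Phi>) (act \<Phi>) \<Longrightarrow> \<exists>c. \<forall>p\<in>B. weight \<Psi> (f p) / weight \<Phi> p = c"
proof -
  from assms obtain f where "bij_betw f (support \<Phi>) (support \<Psi>) \<and>
      (\<forall>\<alpha>\<in>carrier G. \<forall>p\<in>support \<Phi>. f (act \<Phi> \<alpha> p) = act \<Psi> \<alpha> (f p)) \<and>
      (\<forall>B\<in>orbits G (support \<Phi>) (act \<Phi>). \<exists>c. \<forall>p\<in>B. weight \<Psi> (f p) / weight \<Phi> p = c)"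
    unfolding wpa_equiv_def ..
  then show thesis by (intro that[of f]) simp_all
qed

text \<open>A special case of transitivity: \<open>e\<close> preserves weights exactly, so the
  constant on each orbit of \<open>\<Phi>\<close> survives and no orbit has to be followed through
  \<open>f\<close>.\<close>

lemma wpa_equiv_trans_strict:
  assumes "wpa_equiv G \<Phi> \<Psi>"
    and bij: "bij_betw e (support \<Psi>) (support \<Psi>')"
    and act: "\<And>\<alpha> p. \<alpha> \<in> carrier G \<Longrightarrow> p \<in> support \<Psi> \<Longrightarrow> e (act \<Psi> \<alpha> p) = act \<Psi>' \<alpha> (e p)"
    and weight: "\<And>p. p \<in> support \<Psi> \<Longrightarrow> weight \<Psi>' (e p) = weight \<Psi> p"
    and orbits: "\<And>B. B \<in> orbits G (support \<Phi>) (act \<Phi>) \<Longrightarrow> B \<subseteq> support \<Phi>"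
  shows "wpa_equiv G \<Phi> \<Psi>'"
proof -
  obtain f where f: "bij_betw f (support \<Phi>) (support \<Psi>)"
    "\<And>\<alpha> p. \<alpha> \<in> carrier G \<Longrightarrow> p \<in> support \<Phi> \<Longrightarrow> f (act \<Phi> \<alpha> p) = act \<Psi> \<alpha> (f p)"
    "\<And>B. B \<in> orbits G (support \<Phi>) (act \<Phi>) \<Longrightarrow> \<exists>c. \<forall>p\<in>B. weight \<Psi> (f p) / weight \<Phi> p = c"
    by (rule wpa_equivE[OF assms(1)]) (rule that)
  have f_in: "f p \<in> support \<Psi>" if "p \<in> support \<Phi>" for p
    using f(1) that by (rule bij_betwE[rule_format])
  show ?thesis
    unfolding wpa_equiv_def
  proof (intro exI[of _ "e \<circ> f"] conjI ballI)
    show "bij_betw (e \<circ> f) (support \<Phi>) (support \<Psi>')"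
      using f(1) bij by (rule bij_betw_trans)
    show "(e \<circ> f) (act \<Phi> \<alpha> p) = act \<Psi>' \<alpha> ((e \<circ> f) p)"
      if "\<alpha> \<in> carrier G" "p \<in> support \<Phi>" for \<alpha> p
      using f(2)[OF that] act[OF that(1) f_in[OF that(2)]] by simp
    fix B assume B: "B \<in> orbits G (support \<Phi>) (act \<Phi>)"
    then obtain c where c: "\<And>p. p \<in> B \<Longrightarrow> weight \<Psi> (f p) / weight \<Phi> p = c"
      using f(3) by blast
    have "weight \<Psi>' ((e \<circ> f) p) / weight \<Phi> p = c" if "p \<in> B" for p
    proof -
      have "p \<in> support \<Phi>" using orbits[OF B] that by blast
      then show ?thesis using c[OF that] weight[OF f_in, of p] by simp
    qed
    then show "\<exists>c. \<forall>p\<in>B. weight \<Psi>' ((e \<circ> f) p) / weight \<Phi> p = c" by blast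
  qed
qed

section \<open>Direct sums, copies and regrouping of summands\<close>

lemma support_direct_sum [simp]: "support (direct_sum I \<Phi>) = (SIGMA i:I. support (\<Phi> i))"
  by (simp add: direct_sum_def)

lemma weight_direct_sum [simp]: "weight (direct_sum I \<Phi>) (i, p) = weight (\<Phi> i) p"
  by (simp add: direct_sum_def)

lemma act_direct_sum [simp]:
  "i \<in> I \<Longrightarrow> p \<in> support (\<Phi> i) \<Longrightarrow> act (direct_sum I \<Phi>) \<alpha> (i, p) = (i, act (\<Phi> i) \<alpha> p)"
  by (simp add: direct_sum_def)

lemma support_copies [simp]: "support (copies n \<Phi>) = {..<n} \<times> support \<Phi>"
  by (auto simp: copies_def)

lemma weight_copies [simp]: "weight (copies n \<Phi>) (i, p) = weight \<Phi> p"
  by (simp add: copies_def)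

lemma act_copies [simp]:
  "i < n \<Longrightarrow> p \<in> support \<Phi> \<Longrightarrow> act (copies n \<Phi>) \<alpha> (i, p) = (i, act \<Phi> \<alpha> p)"
  by (simp add: copies_def)

lemma support_coset_wpa [simp]: "support (coset_wpa G \<theta> H \<xi>) = lcosets\<^bsub>G\<^esub> H"
  by (simp add: coset_wpa_def)

lemma act_coset_wpa [simp]:
  "C \<in> lcosets\<^bsub>G\<^esub> H \<Longrightarrow> act (coset_wpa G \<theta> H \<xi>) \<alpha> C = \<alpha> <#\<^bsub>G\<^esub> C"
  by (simp add: coset_wpa_def)

text \<open>Both sides contain each \<open>\<Psi> x\<close> equally often, so a bijection between
  the labels of its copies is enough; points inside a copy stay put.\<close>

lemma wpa_equiv_regroup:
  fixes \<Psi> :: "'i \<Rightarrow> ('a, 'y) wpa"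
  assumes equiv: "wpa_equiv G \<Phi> (direct_sum P (\<lambda>x. copies (m x) (\<Psi> x)))"
    and orbits: "\<And>B. B \<in> orbits G (support \<Phi>) (act \<Phi>) \<Longrightarrow> B \<subseteq> support \<Phi>"
    and act_closed: "\<And>x \<alpha> p. x \<in> P \<Longrightarrow> \<alpha> \<in> carrier G \<Longrightarrow> p \<in> support (\<Psi> x) \<Longrightarrow> act (\<Psi> x) \<alpha> p \<in> support (\<Psi> x)"
    and fin: "finite A"
    and sub: "\<And>\<alpha>. \<alpha> \<in> A \<Longrightarrow> Q \<alpha> \<subseteq> P"
    and count: "\<And>x. x \<in> P \<Longrightarrow> m x = (\<Sum>\<alpha>\<in>A. if x \<in> Q \<alpha> then n \<alpha> else 0)"
  shows "wpa_equiv G \<Phi> (direct_sum A (\<lambda>\<alpha>. copies (n \<alpha>) (direct_sum (Q \<alpha>) \<Psi>)))"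
proof -
  \<comment> \<open>The slots for \<open>x\<close> on the regrouped side: a block
    \<open>\<alpha>\<close> using \<open>x\<close> together with a copy number of that
    block.\<close>
  define S where "S x = (SIGMA \<alpha>:{\<alpha> \<in> A. x \<in> Q \<alpha>}. {..<n \<alpha>})" for x
  have "\<exists>g. bij_betw g {..<m x} (S x)" if x: "x \<in> P" for x
  proof (rule finite_same_card_bij)
    show "finite (S x)" using fin by (simp add: S_def)
    have "card (S x) = (\<Sum>\<alpha>\<in>{\<alpha> \<in> A. x \<in> Q \<alpha>}. n \<alpha>)"
      using fin by (simp add: S_def)
    also have "\<dots> = m x"
      using fin by (simp add: count[OF x] sum.inter_filter)
    finally show "card {..<m x} = card (S x)" by simp
  qed simp
  then obtain g where g: "\<And>x. x \<in> P \<Longrightarrow> bij_betw (g x) {..<m x} (S x)"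
    by metis
  define e where "e = (\<lambda>(x, i, p :: 'y). (fst (g x i), snd (g x i), x, p))"
  have g_in: "fst (g x i) \<in> A" "x \<in> Q (fst (g x i))" "snd (g x i) < n (fst (g x i))"
    if "x \<in> P" "i < m x" for x i
  proof -
    have "g x i \<in> S x" using bij_betwE[OF g[OF that(1)]] that(2) by blast
    then show "fst (g x i) \<in> A" "x \<in> Q (fst (g x i))" "snd (g x i) < n (fst (g x i))"
      by (auto simp: S_def)
  qed
  define \<Psi>1 where "\<Psi>1 = direct_sum P (\<lambda>x. copies (m x) (\<Psi> x))"
  define \<Psi>2 where "\<Psi>2 = direct_sum A (\<lambda>\<alpha>. copies (n \<alpha>) (direct_sum (Q \<alpha>) \<Psi>))"
  have act1: "act \<Psi>1 \<alpha> (x, i, p) = (x, i, act (\<Psi> x) \<alpha> p)"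
    if "x \<in> P" "i < m x" "p \<in> support (\<Psi> x)" for \<alpha> x i p
    using that by (simp add: \<Psi>1_def)
  have act2: "act \<Psi>2 \<alpha> (\<beta>, i, x, p) = (\<beta>, i, x, act (\<Psi> x) \<alpha> p)"
    if "\<beta> \<in> A" "i < n \<beta>" "x \<in> Q \<beta>" "p \<in> support (\<Psi> x)" for \<alpha> \<beta> i x p
    using that by (simp add: \<Psi>2_def)
  have supp1: "(x, i, p) \<in> support \<Psi>1 \<longleftrightarrow> x \<in> P \<and> i < m x \<and> p \<in> support (\<Psi> x)" for x i p
    by (simp add: \<Psi>1_def)
  have supp2: "(\<beta>, i, x, p) \<in> support \<Psi>2 \<longleftrightarrow> \<beta> \<in> A \<and> i < n \<beta> \<and> x \<in> Q \<beta> \<and> p \<in> support (\<Psi> x)" for \<beta> i x p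
    by (simp add: \<Psi>2_def)
  have "bij_betw e (support \<Psi>1) (support \<Psi>2)"
  proof (rule bij_betw_imageI)
    show "inj_on e (support \<Psi>1)"
    proof (rule inj_onI)
      fix p q assume pq: "p \<in> support \<Psi>1" "q \<in> support \<Psi>1" "e p = e q"
      obtain x i y where p: "p = (x, i, y)" by (metis surj_pair)
      obtain x' j y' where q: "q = (x', j, y')" by (metis surj_pair)
      have "x' = x" "y' = y" "g x i = g x j"
        using pq(3) by (auto simp: p q e_def prod_eq_iff)
      then show "p = q"
        using pq(1,2) bij_betw_imp_inj_on[OF g[of x]] by (auto simp: p q supp1 inj_on_def)
    qed
    show "e ` support \<Psi>1 = support \<Psi>2"
    proof (intro equalityI subsetI)
      fix q assume "q \<in> e ` support \<Psi>1"
      then obtain x i y where "(x, i, y) \<in> support \<Psi>1" "q = e (x, i, y)" by auto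
      then show "q \<in> support \<Psi>2" using g_in by (simp add: e_def supp1 supp2)
    next
      fix q assume q2: "q \<in> support \<Psi>2"
      obtain \<beta> i x y where q: "q = (\<beta>, i, x, y)" by (metis surj_pair)
      have b: "\<beta> \<in> A" "i < n \<beta>" "x \<in> Q \<beta>" "y \<in> support (\<Psi> x)"
        using q2 by (simp_all add: q supp2)
      then have x: "x \<in> P" using sub by blast
      have "(\<beta>, i) \<in> S x" using b by (simp add: S_def)
      then obtain j where "j < m x" "g x j = (\<beta>, i)"
        using bij_betw_imp_surj_on[OF g[OF x]] by (metis imageE lessThan_iff)
      then have "(x, j, y) \<in> support \<Psi>1" "q = e (x, j, y)"
        using x b by (simp_all add: supp1 q e_def)
      then show "q \<in> e ` support \<Psi>1" by blast
    qed
  qed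
  moreover have "e (act \<Psi>1 \<alpha> p) = act \<Psi>2 \<alpha> (e p)" if "\<alpha> \<in> carrier G" "p \<in> support \<Psi>1" for \<alpha> p
  proof -
    obtain x i y where p: "p = (x, i, y)" by (metis surj_pair)
    then show ?thesis
      using that g_in by (simp add: supp1 act1 act2 e_def)
  qed
  moreover have "weight \<Psi>2 (e p) = weight \<Psi>1 p" if "p \<in> support \<Psi>1" for p
  proof -
    obtain x i y where p: "p = (x, i, y)" by (metis surj_pair)
    then show ?thesis by (simp add: e_def \<Psi>1_def \<Psi>2_def)
  qed
  ultimately show ?thesis
    using wpa_equiv_trans_strict[OF equiv[folded \<Psi>1_def] _ _ _ orbits] unfolding \<Psi>2_def by blast
qed

section \<open>Coset WPAs and the \<Upsilon> of their sums\<close>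

context completely_degenerate_quadratic_group
begin

text \<open>As \<open>\<xi>\<close> and \<open>\<theta>\<close> agree on \<open>H\<close>, their
  quotient takes one value on the coset, which is what \<open>the_elem\<close> needs.\<close>

lemma weight_coset_wpa:
  assumes P: "(H, \<xi>) \<in> coset_params G \<theta>" and a: "a \<in> carrier G"
  shows "weight (coset_wpa G \<theta> H \<xi>) (a <# H) = \<theta> a / \<xi> a"
proof -
  have H: "subgroup H G" and \<xi>: "\<xi> \<in> characters G" "\<And>h. h \<in> H \<Longrightarrow> \<xi> h = \<theta> h"
    using P by (auto simp: coset_params_iff)
  interpret H: subgroup H G by fact
  have "\<theta> (a \<otimes> h) / \<xi> (a \<otimes> h) = \<theta> a / \<xi> a" if "h \<in> H" for h
    using a that \<xi> theta_nonzero[of h] by (simp add: theta_mult character_mult)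
  moreover have "a <# H \<noteq> {}" unfolding l_coset_def using H.one_closed by blast
  ultimately have "(\<lambda>\<alpha>. \<theta> \<alpha> / \<xi> \<alpha>) ` (a <# H) = {\<theta> a / \<xi> a}"
    by (auto simp: l_coset_def image_iff)
  then show ?thesis by (simp add: coset_wpa_def)
qed

lemma lcosets_translate:
  assumes "subgroup H G" "a \<in> carrier G" "C \<in> lcosets H"
  shows "a <# C \<in> lcosets H"
  using assms lcos_m_assoc[of H] subgroup.subset[OF assms(1)] by (auto simp: LCOSETS_def)

text \<open>Commutativity moves \<open>a\<close> past the coset representative, so every point of
  G/H has \<open>H\<close> itself as stabilizer.\<close>

lemma lcoset_fixed_iff:
  assumes H: "subgroup H G" and a: "a \<in> carrier G" and C: "C \<in> lcosets H"
  shows "a <# C = C \<longleftrightarrow> a \<in> H"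
proof -
  interpret H: subgroup H G by fact
  obtain c where c: "c \<in> carrier G" "C = c <# H" using C by (auto simp: LCOSETS_def)
  have ac: "a <# C = (a \<otimes> c) <# H" using a c H.subset by (simp add: lcos_m_assoc)
  show ?thesis
  proof
    assume "a <# C = C"
    then have "a \<otimes> c \<in> c <# H"
      using lcos_self[of "a \<otimes> c" H] a c H ac by simp
    then obtain h where h: "h \<in> H" "a \<otimes> c = c \<otimes> h" by (auto simp: l_coset_def)
    then have "a \<otimes> c = h \<otimes> c" using c(1) by (simp add: m_comm)
    then have "a = h" using a c(1) h(1) by simp
    then show "a \<in> H" using h(1) by simp
  next
    assume "a \<in> H"
    then have "a \<otimes> c \<in> c <# H" using c(1) a by (auto simp: l_coset_def m_comm)
    then show "a <# C = C"
      using l_repr_independence[of "a \<otimes> c" c H] c H ac by simp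
  qed
qed

text \<open>The representative of \<open>C\<close> cancels, so each fixed point contributes equally
  to \<Upsilon>; the denominator \<open>\<theta> b\<close> cancels the prefactor there.\<close>

lemma weight_ratio_coset_wpa:
  assumes P: "(H, \<xi>) \<in> coset_params G \<theta>" and b: "b \<in> carrier G" and C: "C \<in> lcosets H"
  shows "weight (coset_wpa G \<theta> H \<xi>) C / weight (coset_wpa G \<theta> H \<xi>) (b <# C) = \<xi> b / \<theta> b"
    and "weight (coset_wpa G \<theta> H \<xi>) C \<noteq> 0"
proof -
  have H: "subgroup H G" and \<xi>: "\<xi> \<in> characters G"
    using P by (auto simp: coset_params_iff)
  obtain c where c: "c \<in> carrier G" "C = c <# H" using C by (auto simp: LCOSETS_def)
  have bc: "b <# C = (b \<otimes> c) <# H" using b c subgroup.subset[OF H] by (simp add: lcos_m_assoc)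
  show "weight (coset_wpa G \<theta> H \<xi>) C \<noteq> 0"
    using c weight_coset_wpa[OF P] theta_nonzero character_nonzero[OF \<xi>] by simp
  show "weight (coset_wpa G \<theta> H \<xi>) C / weight (coset_wpa G \<theta> H \<xi>) (b <# C) = \<xi> b / \<theta> b"
    unfolding bc unfolding c(2)
    using b c(1) theta_nonzero[of c] character_nonzero[OF \<xi>, of c]
    by (simp add: weight_coset_wpa[OF P] theta_mult character_mult[OF \<xi>])
qed

abbreviation coset_sum ::
    "('a set \<times> ('a \<Rightarrow> complex) \<Rightarrow> nat) \<Rightarrow> ('a, ('a set \<times> ('a \<Rightarrow> complex)) \<times> nat \<times> 'a set) wpa" where
  "coset_sum m \<equiv> direct_sum (coset_params G \<theta>) (\<lambda>(H, \<xi>). copies (m (H, \<xi>)) (coset_wpa G \<theta> H \<xi>))"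

lemma coset_sum_mem:
  "((H, \<xi>), i, C) \<in> support (coset_sum m) \<longleftrightarrow>
     (H, \<xi>) \<in> coset_params G \<theta> \<and> i < m (H, \<xi>) \<and> C \<in> lcosets H"
  by auto

lemma coset_sum_act:
  "((H, \<xi>), i, C) \<in> support (coset_sum m) \<Longrightarrow> act (coset_sum m) a ((H, \<xi>), i, C) = ((H, \<xi>), i, a <# C)"
  by simp

lemma coset_sum_weight:
  "weight (coset_sum m) ((H, \<xi>), i, C) = weight (coset_wpa G \<theta> H \<xi>) C"
  by simp

text \<open>An element fixes all of G/H or nothing, according to whether it lies in
  \<open>H\<close>. Hence a summand contributes its multiplicity times the index times
  \<open>\<xi> b\<close>.\<close>

lemma Upsilon_coset_sum:
  assumes a: "a \<in> carrier G" and b: "b \<in> carrier G"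
  shows "Upsilon \<theta> (coset_sum m) a b = multiplicity_Upsilon (\<lambda>x. of_nat (m x)) a b"
proof -
  have Fix: "fixed_points (coset_sum m) a
      = (SIGMA x:{x \<in> coset_params G \<theta>. a \<in> fst x}. {..<m x} \<times> lcosets (fst x))"
  proof (rule Set.set_eqI)
    fix p :: "('a set \<times> ('a \<Rightarrow> complex)) \<times> nat \<times> 'a set"
    obtain H \<xi> i C where p: "p = ((H, \<xi>), i, C)" by (metis surj_pair)
    have "p \<in> fixed_points (coset_sum m) a \<longleftrightarrow> p \<in> support (coset_sum m) \<and> a <# C = C"
      using coset_sum_act[of H \<xi> i C m a] by (auto simp: fixed_points_def invariants_def p simp del: support_direct_sum act_direct_sum)
    also have "\<dots> \<longleftrightarrow> p \<in> support (coset_sum m) \<and> a \<in> H"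
      using lcoset_fixed_iff[OF _ a] unfolding p coset_sum_mem by (auto simp: coset_params_iff)
    also have "\<dots> \<longleftrightarrow> p \<in> (SIGMA x:{x \<in> coset_params G \<theta>. a \<in> fst x}. {..<m x} \<times> lcosets (fst x))"
      unfolding p coset_sum_mem by auto
    finally show "p \<in> fixed_points (coset_sum m) a
      \<longleftrightarrow> p \<in> (SIGMA x:{x \<in> coset_params G \<theta>. a \<in> fst x}. {..<m x} \<times> lcosets (fst x))" .
  qed
  have fin: "finite (lcosets H)" if "subgroup H G" for H
    using finite_carrier by (simp add: LCOSETS_def)
  have "(\<Sum>p\<in>fixed_points (coset_sum m) a. weight (coset_sum m) p / weight (coset_sum m) (act (coset_sum m) b p))
      = (\<Sum>p\<in>fixed_points (coset_sum m) a. snd (fst p) b / \<theta> b)"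
  proof (rule sum.cong[OF refl])
    fix p assume "p \<in> fixed_points (coset_sum m) a"
    then have mem: "p \<in> support (coset_sum m)" by (simp add: fixed_points_def invariants_def)
    obtain H \<xi> i C where p: "p = ((H, \<xi>), i, C)" by (metis surj_pair)
    have P: "(H, \<xi>) \<in> coset_params G \<theta>" "C \<in> lcosets H"
      using mem unfolding p coset_sum_mem by auto
    show "weight (coset_sum m) p / weight (coset_sum m) (act (coset_sum m) b p) = snd (fst p) b / \<theta> b"
      unfolding p coset_sum_act[OF mem[unfolded p]] coset_sum_weight
      using weight_ratio_coset_wpa(1)[OF P(1) b P(2)] by simp
  qed
  also have "\<dots> = (\<Sum>x\<in>{x \<in> coset_params G \<theta>. a \<in> fst x}. \<Sum>y\<in>{..<m x} \<times> lcosets (fst x). snd x b / \<theta> b)"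
    unfolding Fix using finite_coset_params fin
    by (subst sum.Sigma) (auto simp: coset_params_iff split_def)
  also have "\<dots> = (\<Sum>x\<in>{x \<in> coset_params G \<theta>. a \<in> fst x}.
      of_nat (m x) * (subgroup_index (fst x) * snd x b) / \<theta> b)"
    by (intro sum.cong refl) (simp add: card_cartesian_product)
  also have "\<dots> = multiplicity_Upsilon (\<lambda>x. of_nat (m x)) a b / \<theta> b"
    unfolding multiplicity_Upsilon_def sum_divide_distrib
    using finite_coset_params by (simp add: sum.inter_filter) (intro sum.cong refl, auto)
  finally show ?thesis
    using theta_nonzero[OF b] by (simp add: Upsilon_def)
qed

end

context weighted_permutation_action
begin

sublocale action: group_action G "support \<Phi>" "act \<Phi>"
  by (rule action)

lemma orbit_subset: "B \<in> orbits G (support \<Phi>) (act \<Phi>) \<Longrightarrow> B \<subseteq> support \<Phi>"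
  using action.element_image by (auto simp: orbits_def orbit_def)

text \<open>A point and its translate by \<open>b\<close> lie in one orbit, so the constant relating
  the two weights cancels in the ratio.\<close>

lemma Upsilon_wpa_equiv:
  assumes f: "bij_betw f (support \<Phi>) (support \<Psi>)"
    "\<And>\<alpha> p. \<alpha> \<in> carrier G \<Longrightarrow> p \<in> support \<Phi> \<Longrightarrow> f (act \<Phi> \<alpha> p) = act \<Psi> \<alpha> (f p)"
    "\<And>B. B \<in> orbits G (support \<Phi>) (act \<Phi>) \<Longrightarrow> \<exists>c. \<forall>p\<in>B. weight \<Psi> (f p) / weight \<Phi> p = c"
    and nz: "\<And>p. p \<in> support \<Psi> \<Longrightarrow> weight \<Psi> p \<noteq> 0"
    and a: "a \<in> carrier G" and b: "b \<in> carrier G"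
  shows "Upsilon \<theta> \<Phi> a b = Upsilon \<theta> \<Psi> a b"
proof -
  have f_in: "f p \<in> support \<Psi>" if "p \<in> support \<Phi>" for p
    using f(1) that by (rule bij_betwE[rule_format])
  have w_nz: "weight \<Phi> p \<noteq> 0" if "p \<in> support \<Phi>" for p
    using weight_closed that by auto
  have fixed: "act \<Psi> a (f p) = f p \<longleftrightarrow> act \<Phi> a p = p" if p: "p \<in> support \<Phi>" for p
    using bij_betw_imp_inj_on[OF f(1)] action.element_image[OF a p refl] p
    by (simp add: f(2)[OF a p, symmetric] inj_on_eq_iff)
  have "bij_betw f (fixed_points \<Phi> a) (fixed_points \<Psi> a)"
  proof (rule bij_betw_subset[OF f(1)])
    show "fixed_points \<Phi> a \<subseteq> support \<Phi>" by (auto simp: fixed_points_def invariants_def)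
    show "f ` fixed_points \<Phi> a = fixed_points \<Psi> a"
    proof (intro equalityI subsetI)
      fix q assume "q \<in> fixed_points \<Psi> a"
      then have q: "q \<in> support \<Psi>" "act \<Psi> a q = q" by (auto simp: fixed_points_def invariants_def)
      then obtain p where "p \<in> support \<Phi>" "q = f p"
        using bij_betw_imp_surj_on[OF f(1)] by blast
      then show "q \<in> f ` fixed_points \<Phi> a"
        using q(2) fixed by (auto simp: fixed_points_def invariants_def)
    qed (use f_in fixed in \<open>auto simp: fixed_points_def invariants_def\<close>)
  qed
  moreover have "weight \<Phi> p / weight \<Phi> (act \<Phi> b p) = weight \<Psi> (f p) / weight \<Psi> (act \<Psi> b (f p))"
    if "p \<in> fixed_points \<Phi> a" for p
  proof -
    have p: "p \<in> support \<Phi>" using that by (simp add: fixed_points_def invariants_def)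
    have bp: "act \<Phi> b p \<in> support \<Phi>" using action.element_image[OF b p refl] .
    have "orbit G (act \<Phi>) p \<in> orbits G (support \<Phi>) (act \<Phi>)"
      using p by (auto simp: orbits_def)
    from f(3)[OF this] obtain c where
      c: "\<And>q. q \<in> orbit G (act \<Phi>) p \<Longrightarrow> weight \<Psi> (f q) / weight \<Phi> q = c" by blast
    have "weight \<Psi> (f p) / weight \<Phi> p = c" "weight \<Psi> (f (act \<Phi> b p)) / weight \<Phi> (act \<Phi> b p) = c"
      using action.orbit_refl[OF p] b by (auto intro!: c simp: orbit_def)
    \<comment> \<open>Cancelling the orbit constant needs it to be nonzero, which follows from
      nonvanishing weights on both sides.\<close>
    moreover have "c \<noteq> 0"
      using calculation(1) nz[OF f_in[OF p]] w_nz[OF p] by auto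
    ultimately show ?thesis
      using w_nz[OF p] w_nz[OF bp] nz[OF f_in[OF p]] nz[OF f_in[OF bp]] f(2)[OF b p]
      by (auto simp: field_simps)
  qed
  ultimately show ?thesis
    unfolding Upsilon_def by (simp add: sum.reindex_bij_betw[symmetric])
qed

lemma cyclic_stabilizer:
  assumes "cyclic_wpa G \<Phi>" and p: "p \<in> support \<Phi>"
  obtains g where "g \<in> carrier G" "stabilizer G (act \<Phi>) p = generate G {g}"
proof -
  let ?S = "stabilizer G (act \<Phi>) p"
  have S: "subgroup ?S G" using action.stabilizer_subgroup[OF p] .
  interpret S: group "G\<lparr>carrier := ?S\<rparr>" by (rule subgroup_imp_group[OF S])
  have "cyclic_group (G\<lparr>carrier := ?S\<rparr>)"
    using assms by (simp add: cyclic_wpa_def)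
  then obtain g where g: "g \<in> ?S" "?S = range (\<lambda>n::int. g [^]\<^bsub>G\<lparr>carrier := ?S\<rparr>\<^esub> n)"
    using S.cyclic_group by auto
  have gG: "g \<in> carrier G" using g(1) subgroup.subset[OF S] by blast
  have "?S = generate G {g}"
    using g(2) unfolding int_pow_consistent[OF S g(1), symmetric] generate_pow[OF gG] by auto
  with gG that show thesis by blast
qed

end

section \<open>Comparison of \<open>\<Phi>\<close> with the proposed sum\<close>

theorem theorem1:
  fixes G (structure)
    and \<theta> :: "'a \<Rightarrow> complex"
    and \<Phi> :: "('a, 'x) wpa"
  assumes "completely_degenerate_quadratic_group G \<theta>"
    and "weighted_permutation_action G \<theta> \<Phi>"
    and "admissible G \<theta> \<Phi>"
    and "cyclic_wpa G \<Phi>"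
  shows "\<exists>n :: 'a \<Rightarrow> nat.
           wpa_equiv G \<Phi>
             (direct_sum (carrier G)
               (\<lambda>\<alpha>. copies (n \<alpha>) (admissible_coset_wpa G \<theta> (generate G {\<alpha>}))))"
proof -
  interpret completely_degenerate_quadratic_group G \<theta> by fact
  interpret weighted_permutation_action G \<theta> \<Phi> by fact
  \<comment> \<open>The decomposition is the existential witness inside
    \<open>galois_invariant\<close>.\<close>
  obtain m where equiv: "wpa_equiv G \<Phi> (coset_sum m)"
    using assms(3) unfolding admissible_def galois_invariant_def coset_decomposition_def by blast
  obtain f where f: "bij_betw f (support \<Phi>) (support (coset_sum m))"
    "\<And>\<alpha> p. \<alpha> \<in> carrier G \<Longrightarrow> p \<in> support \<Phi> \<Longrightarrow> f (act \<Phi> \<alpha> p) = act (coset_sum m) \<alpha> (f p)"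
    "\<And>B. B \<in> orbits G (support \<Phi>) (act \<Phi>) \<Longrightarrow> \<exists>c. \<forall>p\<in>B. weight (coset_sum m) (f p) / weight \<Phi> p = c"
    by (rule wpa_equivE[OF equiv]) (rule that)
  have weight_nz: "weight (coset_sum m) p \<noteq> 0" if "p \<in> support (coset_sum m)" for p
  proof -
    obtain H \<xi> i C where p: "p = ((H, \<xi>), i, C)" by (metis surj_pair)
    have "(H, \<xi>) \<in> coset_params G \<theta>" "C \<in> lcosets H"
      using that unfolding p coset_sum_mem by simp_all
    then show ?thesis
      unfolding p coset_sum_weight by (rule weight_ratio_coset_wpa(2)[OF _ one_closed])
  qed
  have Upsilon: "Upsilon \<theta> \<Phi> a b = multiplicity_Upsilon (\<lambda>x. of_nat (m x)) a b"
    if "a \<in> carrier G" "b \<in> carrier G" for a b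
    using Upsilon_wpa_equiv[OF f weight_nz that] Upsilon_coset_sum[OF that] by simp
  have m_cyclic: "\<exists>g. g \<in> carrier G \<and> H = generate G {g}"
    if P: "(H, \<xi>) \<in> coset_params G \<theta>" and pos: "m (H, \<xi>) > 0" for H \<xi>
  proof -
    have H: "subgroup H G" using P by (simp add: coset_params_iff)
    have HH: "H \<in> lcosets H"
      using lcos_mult_one[OF subgroup.subset[OF H]] by (auto simp: LCOSETS_def)
    \<comment> \<open>Positive multiplicity provides copy number 0. Its point \<open>H\<close> has
      stabilizer \<open>H\<close>, and pulling it back along \<open>f\<close> gives a point of
      \<open>\<Phi>\<close> with the same stabilizer.\<close>
    have mem: "((H, \<xi>), 0, H) \<in> support (coset_sum m)"
      unfolding coset_sum_mem using P pos HH by simp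
    then have "((H, \<xi>), 0, H) \<in> f ` support \<Phi>"
      unfolding bij_betw_imp_surj_on[OF f(1)] .
    then obtain p where p: "p \<in> support \<Phi>" "f p = ((H, \<xi>), 0, H)"
      by (elim imageE) simp
    have "stabilizer G (act \<Phi>) p = H"
    proof -
      have "act \<Phi> a p = p \<longleftrightarrow> a \<in> H" if a: "a \<in> carrier G" for a
      proof -
        have "act \<Phi> a p = p \<longleftrightarrow> f (act \<Phi> a p) = f p"
          using bij_betw_imp_inj_on[OF f(1)] action.element_image[OF a p(1) refl] p(1)
          by (simp add: inj_on_eq_iff)
        also have "\<dots> \<longleftrightarrow> a <# H = H"
          unfolding f(2)[OF a p(1)] p(2) coset_sum_act[OF mem] by simp
        finally show ?thesis using lcoset_fixed_iff[OF H a HH] by simp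
      qed
      then show ?thesis using subgroup.subset[OF H] by (auto simp: stabilizer_def)
    qed
    then show ?thesis using cyclic_stabilizer[OF assms(4) p(1)] by metis
  qed
  have gen: "subgroup (generate G {\<alpha>}) G" if "\<alpha> \<in> carrier G" for \<alpha>
    using that by (intro generate_is_subgroup) simp
  \<comment> \<open>The sum runs over elements, but a cyclic subgroup may have several generators;
    one chosen generator carries the whole multiplicity.\<close>
  define rep where "rep K = (SOME g. g \<in> carrier G \<and> K = generate G {g})" for K
  have rep: "rep K \<in> carrier G \<and> K = generate G {rep K}" if "\<exists>g. g \<in> carrier G \<and> K = generate G {g}" for K
    unfolding rep_def using that by (rule someI_ex)
  define n where "n \<alpha> = (if \<alpha> = rep (generate G {\<alpha>}) then m (generate G {\<alpha>}, \<theta>') else 0)" for \<alpha>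
  define Q where "Q \<alpha> = admissible_coset_params G \<theta> (generate G {\<alpha>})" for \<alpha>
  define m' where "m' x = (\<Sum>\<alpha>\<in>carrier G. if x \<in> Q \<alpha> then n \<alpha> else 0)" for x
  \<comment> \<open>The difference is taken in the complex numbers, where it is not truncated and
    Fourier inversion applies.\<close>
  define d :: "'a set \<times> ('a \<Rightarrow> complex) \<Rightarrow> complex" where "d x = of_nat (m x) - of_nat (m' x)" for x
  have U_d: "multiplicity_Upsilon d a b = Upsilon \<theta> \<Phi> a b
      - (\<Sum>\<alpha>\<in>carrier G. of_nat (n \<alpha>) * (\<Sum>(H, \<xi>)\<in>Q \<alpha>. if a \<in> H then subgroup_index H * \<xi> b else 0))"
    if "a \<in> carrier G" "b \<in> carrier G" for a b
  proof -
    have "multiplicity_Upsilon d a b = multiplicity_Upsilon (\<lambda>x. of_nat (m x)) a b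
        - multiplicity_Upsilon (\<lambda>x. of_nat (m' x)) a b"
      unfolding multiplicity_Upsilon_def sum_subtractf[symmetric]
      by (intro sum.cong refl) (auto simp: d_def algebra_simps)
    also have "(\<lambda>x. of_nat (m' x) :: complex)
        = (\<lambda>x. \<Sum>\<alpha>\<in>carrier G. if x \<in> Q \<alpha> then of_nat (n \<alpha>) else 0)"
      unfolding m'_def of_nat_sum by (intro ext sum.cong refl) simp
    finally show ?thesis
      using multiplicity_Upsilon_sum[where A = "carrier G" and K = "\<lambda>\<alpha>. generate G {\<alpha>}"
          and n = "\<lambda>\<alpha>. of_nat (n \<alpha>)", OF finite_carrier gen, of a b]
      by (simp add: Q_def Upsilon[OF that])
  qed
  have d_zero: "d (H, \<xi>) = 0" if "(H, \<xi>) \<in> coset_params G \<theta>" for H \<xi>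
  proof (rule multiplicities_eq_zero[OF _ _ _ _ that])
    fix H \<xi> assume P: "(H, \<xi>) \<in> coset_params G \<theta>" and H: "\<nexists>g. g \<in> carrier G \<and> H = generate G {g}"
    have "m (H, \<xi>) = 0" using m_cyclic[OF P] H by blast
    \<comment> \<open>Both families of each proposed summand live on cyclic subgroups, so a
      noncyclic \<open>H\<close> is absent from them as well.\<close>
    moreover have "(H, \<xi>) \<notin> Q \<alpha>" if \<alpha>: "\<alpha> \<in> carrier G" for \<alpha>
    proof
      assume "(H, \<xi>) \<in> Q \<alpha>"
      then have "H = generate G {\<alpha>} \<or> H = even_part (generate G {\<alpha>})"
        unfolding Q_def admissible_coset_params_eq[OF gen[OF \<alpha>]] by fast
      moreover obtain h where "h \<in> carrier G" "even_part (generate G {\<alpha>}) = generate G {h}"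
        using cyclic_even_part[OF \<alpha>] by (elim exE conjE)
      ultimately show False using H \<alpha> by metis
    qed
    then have "m' (H, \<xi>) = 0" by (simp add: m'_def)
    ultimately show "d (H, \<xi>) = 0" by (simp add: d_def)
  next
    fix H assume H: "subgroup H G"
    \<comment> \<open>At \<open>\<theta>'\<close> only generators of \<open>H\<close> can
      contribute, and among them only the chosen one has nonzero \<open>n\<close>.\<close>
    have "m' (H, \<theta>') = (\<Sum>\<alpha>\<in>carrier G. if \<alpha> = rep H \<and> H = generate G {\<alpha>} then m (H, \<theta>') else 0)"
      unfolding m'_def Q_def
    proof (rule sum.cong[OF refl])
      fix \<alpha> assume "\<alpha> \<in> carrier G"
      from theta'_admissible_coset_params[OF gen[OF this], of H]
      show "(if (H, \<theta>') \<in> admissible_coset_params G \<theta> (generate G {\<alpha>}) then n \<alpha> else 0)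
          = (if \<alpha> = rep H \<and> H = generate G {\<alpha>} then m (H, \<theta>') else 0)"
        by (cases "H = generate G {\<alpha>}") (simp_all add: n_def)
    qed
    also have "\<dots> = m (H, \<theta>')"
    proof (cases "\<exists>g. g \<in> carrier G \<and> H = generate G {g}")
      case True
      have "(\<Sum>\<alpha>\<in>carrier G. if \<alpha> = rep H \<and> H = generate G {\<alpha>} then m (H, \<theta>') else 0)
          = (\<Sum>\<alpha>\<in>carrier G. if \<alpha> = rep H then m (H, \<theta>') else 0)"
        using conjunct2[OF rep[OF True]] by (intro sum.cong refl) metis
      also have "\<dots> = m (H, \<theta>')"
        using conjunct1[OF rep[OF True]] finite_carrier by simp
      finally show ?thesis .
    next
      case False
      then have m0: "m (H, \<theta>') = 0"
        using m_cyclic[of H \<theta>'] theta'_extension[OF H] H by (auto simp: coset_params_iff)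
      show ?thesis unfolding m0 by simp
    qed
    finally show "d (H, \<theta>') = 0" by (simp add: d_def)
  next
    fix a b assume ab: "a \<in> carrier G" "b \<in> carrier G"
    have "Upsilon \<theta> \<Phi> a b = Upsilon \<theta> \<Phi> b a"
      using assms(3) ab by (simp add: admissible_def reciprocity_def)
    then show "multiplicity_Upsilon d a b = multiplicity_Upsilon d b a"
      unfolding U_d[OF ab] U_d[OF ab(2,1)] Q_def
      using admissible_coset_Upsilon_sym[OF gen ab] by (simp cong: sum.cong)
  next
    fix a b assume ab: "a \<in> carrier G" "b \<in> carrier G"
      and no: "\<nexists>g. g \<in> carrier G \<and> a \<in> generate G {g} \<and> b \<in> generate G {g}"
    \<comment> \<open>This makes \<Upsilon> of \<open>\<Phi>\<close> vanish by boundedness; the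
      proposed summands vanish separately, since no \<langle>\<alpha>\<rangle> contains both
      elements.\<close>
    have "fixed_points \<Phi> a \<inter> fixed_points \<Phi> b = {}"
    proof (rule equals0I)
      fix p assume "p \<in> fixed_points \<Phi> a \<inter> fixed_points \<Phi> b"
      then have p: "p \<in> support \<Phi>" "a \<in> stabilizer G (act \<Phi>) p" "b \<in> stabilizer G (act \<Phi>) p"
        using ab by (auto simp: fixed_points_def invariants_def stabilizer_def)
      obtain g where "g \<in> carrier G" "stabilizer G (act \<Phi>) p = generate G {g}"
        using cyclic_stabilizer[OF assms(4) p(1)] .
      then show False using no p(2,3) by blast
    qed
    moreover have "cmod (Upsilon \<theta> \<Phi> a b) \<le> real (card (fixed_points \<Phi> a \<inter> fixed_points \<Phi> b))"
      using assms(3) ab by (simp add: admissible_def boundedness_def)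
    moreover have "(\<Sum>(H, \<xi>)\<in>Q \<alpha>. if a \<in> H then subgroup_index H * \<xi> b else 0) = 0"
      if \<alpha>: "\<alpha> \<in> carrier G" for \<alpha>
    proof -
      have "\<not> (a \<in> generate G {\<alpha>} \<and> b \<in> generate G {\<alpha>})" using no \<alpha> by blast
      then show ?thesis
        unfolding Q_def admissible_coset_Upsilon[OF gen[OF \<alpha>] ab] by (rule if_not_P)
    qed
    ultimately show "multiplicity_Upsilon d a b = 0"
      unfolding U_d[OF ab] by simp
  qed
  have "wpa_equiv G \<Phi>
      (direct_sum (carrier G) (\<lambda>\<alpha>. copies (n \<alpha>) (direct_sum (Q \<alpha>) (\<lambda>(K, \<phi>). coset_wpa G \<theta> K \<phi>))))"
  proof (rule wpa_equiv_regroup[where P = "coset_params G \<theta>" and m = m])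
    show "wpa_equiv G \<Phi> (direct_sum (coset_params G \<theta>)
        (\<lambda>x. copies (m x) (case x of (K, \<phi>) \<Rightarrow> coset_wpa G \<theta> K \<phi>)))"
      using equiv by (simp add: split_def)
    show "Q \<alpha> \<subseteq> coset_params G \<theta>" if "\<alpha> \<in> carrier G" for \<alpha>
      unfolding Q_def by (rule admissible_coset_params_subset[OF gen[OF that]])
    show "m x = (\<Sum>\<alpha>\<in>carrier G. if x \<in> Q \<alpha> then n \<alpha> else 0)" if "x \<in> coset_params G \<theta>" for x
    proof -
      \<comment> \<open>Injectivity of \<open>of_nat\<close> returns the vanishing of
        \<open>d\<close> to an equality of natural multiplicities.\<close>
      have "(of_nat (m x) :: complex) = of_nat (m' x)"
        using d_zero[of "fst x" "snd x"] that by (simp add: d_def)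
      then show ?thesis unfolding m'_def of_nat_eq_iff .
    qed
    show "act (case x of (K, \<phi>) \<Rightarrow> coset_wpa G \<theta> K \<phi>) \<alpha> p \<in> support (case x of (K, \<phi>) \<Rightarrow> coset_wpa G \<theta> K \<phi>)"
      if "x \<in> coset_params G \<theta>" "\<alpha> \<in> carrier G" "p \<in> support (case x of (K, \<phi>) \<Rightarrow> coset_wpa G \<theta> K \<phi>)" for x \<alpha> p
      using that lcosets_translate by (cases x) (simp add: coset_params_iff)
  qed (use orbit_subset finite_carrier in auto)
  then show ?thesis
    unfolding Q_def admissible_coset_wpa_def[symmetric] by (rule exI[of _ n])
qed

end
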